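(* Let $X=CI(d_1,\ldots,d_n)\subseteq\mathbb{P}^n$ with $2\leq d_1\leq\cdots\leq d_n$, and suppose $X$ splits as $X=X_1\cup X_2=CI(d_1-1,d_2,\ldots,d_n)\cup CI(1,d_2,\ldots,d_n)$. If $Z=\{X;m\}$ and $Y=Z\setminus\{(P,m)\}$ with $P\in X_2$, then \[ \operatorname{ri}(Y)\geq d_1+\cdots+d_{n-1}+md_n-(n+1). \]
   Context: $k$ is an algebraically closed field of characteristic $0$, $R=k[x_0,\ldots,x_n]$ has the standard grading, $\mathbb{P}^n=\mathbb{P}^n_k$, and $m$ is a positive integer. A complete intersection of points of type $(e_1,\ldots,e_n)$ (in any order), denoted $CI(e_1,\ldots,e_n)\subseteq\mathbb{P}^n$, is a set of $\prod_{i=1}^n e_i$ reduced points whose defining ideal is $(F_1,\ldots,F_n)$, where $F_1,\ldots,F_n$ is a regular sequence of homogeneous forms with $\deg F_i=e_i$, this ideal being radical. That $X=CI(d_1,\ldots,d_n)$ splits as $X=X_1\cup X_2=CI(d_1-1,d_2,\ldots,d_n)\cup CI(1,d_2,\ldots,d_n)$ means that $X$ is the disjoint union of two complete intersections of points $X_1$, $X_2$ of the indicated types. For a finite set of points $X$ and $m\geq 1$, $\{X;m\}$ denotes the fat point scheme defined by $\bigcap_{Q\in X}\wp_Q^m$, where $\wp_Q\subseteq R$ is the defining ideal of the point $Q$; for $P\in X$, $\{X;m\}\setminus\{(P,m)\}$ is the fat point scheme defined by $\bigcap_{Q\in X\setminus\{P\}}\wp_Q^m$. For a fat point scheme $W=\{(P_1,m_1),\ldots,(P_s,m_s)\}\subseteq\mathbb{P}^n$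 with defining ideal $I_W=\bigcap_j\wp_{P_j}^{m_j}$, the regularity index is \[ \operatorname{ri}(W):=\min\left\{i \;\middle|\; \dim_k(R/I_W)_i=\deg(W):=\sum_{j=1}^s\binom{n+m_j-1}{n}\right\}. \]
   Formalization: The formal theorem assumes n ≥ 2; for n = 1 and m ≥ 2 the claim fails (d_1 = 2, m = 2: Y is one double point on the projective line, ri(Y) = 1 < 2). The trivial case n = 1, m = 1 is also left out. *)

theory Defs
  imports
    "HOL-Library.Poly_Mapping"
    "HOL-Library.FuncSet"
    "HOL-Library.Cardinality"
    "HOL-Computational_Algebra.Polynomial"
begin

section \<open>The polynomial ring and its ideals\<close>

text \<open>
  A polynomial over \<open>'k\<close> in variables indexed by the finite type \<open>'v\<close> is a finitely supported
  function from exponent vectors to coefficients, and HOL-Library makes this type a commutative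
  ring.  With \<open>CARD('v) = n + 1\<close> the type is the ring \<open>k[x_0,...,x_n]\<close>.
\<close>

type_synonym ('v, 'k) mpoly = "('v \<Rightarrow>\<^sub>0 nat) \<Rightarrow>\<^sub>0 'k"

text \<open>A ring is a module over itself; its submodules (\<open>ideal.subspace\<close>) are the ideals, and
  \<open>ideal.span S\<close> is the ideal generated by \<open>S\<close>.\<close>

global_interpretation ideal: module "(*) :: 'a::comm_ring_1 \<Rightarrow> 'a \<Rightarrow> 'a"
  by unfold_locales (simp_all add: algebra_simps)

primrec ideal_pow :: "'a::comm_ring_1 set \<Rightarrow> nat \<Rightarrow> 'a set" where
  "ideal_pow I 0 = UNIV"
| "ideal_pow I (Suc m) = ideal.span {a * b |a b. a \<in> I \<and> b \<in> ideal_pow I m}"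

definition radical_ideal :: "'a::comm_ring_1 set \<Rightarrow> bool" where
  "radical_ideal I \<longleftrightarrow> ideal.subspace I \<and> (\<forall>f k. f ^ k \<in> I \<longrightarrow> f \<in> I)"

definition regular_sequence :: "nat \<Rightarrow> (nat \<Rightarrow> 'a::comm_ring_1) \<Rightarrow> bool" where
  "regular_sequence r F \<longleftrightarrow>
     ideal.span (F ` {1..r}) \<noteq> UNIV \<and>
     (\<forall>i\<in>{1..r}. \<forall>g. F i * g \<in> ideal.span (F ` {1..<i}) \<longrightarrow> g \<in> ideal.span (F ` {1..<i}))"

definition forms :: "nat \<Rightarrow> ('v::finite, 'k::field) mpoly set" where
  "forms i = {f. \<forall>t\<in>Poly_Mapping.keys f. (\<Sum>v\<in>UNIV. Poly_Mapping.lookup t v) = i}"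

definition eval_mpoly :: "('v::finite, 'k::field) mpoly \<Rightarrow> ('v \<Rightarrow> 'k) \<Rightarrow> 'k" where
  "eval_mpoly f x = (\<Sum>t\<in>Poly_Mapping.keys f. Poly_Mapping.lookup f t * (\<Prod>v\<in>UNIV. x v ^ Poly_Mapping.lookup t v))"

definition smult_mpoly :: "'k \<Rightarrow> ('v::finite, 'k::field) mpoly \<Rightarrow> ('v, 'k) mpoly" where
  "smult_mpoly c f = Poly_Mapping.single 0 c * f"

global_interpretation mpoly_vs: vector_space
  "smult_mpoly :: 'k \<Rightarrow> ('v::finite, 'k::field) mpoly \<Rightarrow> ('v, 'k) mpoly"
proof
  show "smult_mpoly a (smult_mpoly b f) = smult_mpoly (a * b) f"
    for a b and f :: "('v, 'k) mpoly"
    by (simp add: smult_mpoly_def mult_single flip: mult.assoc)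
qed (simp_all add: smult_mpoly_def distrib_left distrib_right single_add)


section \<open>Projective points and their ideals\<close>

text \<open>A point of projective space is the set of all its homogeneous coordinate vectors.\<close>

definition proj_rel :: "(('v::finite \<Rightarrow> 'k::field) \<times> ('v \<Rightarrow> 'k)) set" where
  "proj_rel = {(x, y). x \<noteq> (\<lambda>_. 0) \<and> (\<exists>c. c \<noteq> 0 \<and> y = (\<lambda>v. c * x v))}"

definition proj_space :: "('v::finite \<Rightarrow> 'k::field) set set" where
  "proj_space = {x. x \<noteq> (\<lambda>_. 0)} // proj_rel"

definition vanishing_ideal :: "('v::finite \<Rightarrow> 'k::field) set set \<Rightarrow> ('v, 'k) mpoly set" where
  "vanishing_ideal S =
     ideal.span {f. (\<exists>i. f \<in> forms i) \<and> (\<forall>Q\<in>S. \<forall>x\<in>Q. eval_mpoly f x = 0)}"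

text \<open>
  \<open>CI_points n e X\<close>: the set \<open>X\<close> is a complete intersection of points of type
  \<open>(e 1, ..., e n)\<close>; the \<open>e i\<close> need not be sorted.
\<close>

definition CI_points :: "nat \<Rightarrow> (nat \<Rightarrow> nat) \<Rightarrow> ('v::finite \<Rightarrow> 'k::field) set set \<Rightarrow> bool" where
  "CI_points n e X \<longleftrightarrow>
     X \<subseteq> proj_space \<and> finite X \<and> card X = (\<Prod>i=1..n. e i) \<and>
     (\<exists>F :: nat \<Rightarrow> ('v, 'k) mpoly.
        regular_sequence n F \<and> (\<forall>i\<in>{1..n}. F i \<in> forms (e i)) \<and>
        vanishing_ideal X = ideal.span (F ` {1..n}) \<and>
        radical_ideal (ideal.span (F ` {1..n})))"


section \<open>Fat points, Hilbert function and regularity index\<close>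

text \<open>A fat point scheme is given by its finite set of pairs (point, multiplicity).\<close>

type_synonym ('v, 'k) fat_points = "(('v \<Rightarrow> 'k) set \<times> nat) set"

definition fat :: "('v::finite \<Rightarrow> 'k::field) set set \<Rightarrow> nat \<Rightarrow> ('v, 'k) fat_points" where
  "fat X m = (\<lambda>Q. (Q, m)) ` X"

definition fat_ideal :: "('v::finite, 'k::field) fat_points \<Rightarrow> ('v, 'k) mpoly set" where
  "fat_ideal W = (\<Inter>(Q, m)\<in>W. ideal_pow (vanishing_ideal {Q}) m)"

text \<open>With \<open>CARD('v) = n + 1\<close>, the summand is \<open>(n + m - 1) choose n\<close>.\<close>

definition fat_degree :: "('v::finite, 'k::field) fat_points \<Rightarrow> nat" where
  "fat_degree W = (\<Sum>(Q, m)\<in>W. (CARD('v) - 1 + m - 1) choose (CARD('v) - 1))"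

text \<open>The residue classes of the members of \<open>B\<close> form a basis of \<open>V / (V \<inter> I)\<close>.\<close>

definition basis_modulo ::
  "('v::finite, 'k::field) mpoly set \<Rightarrow> ('v, 'k) mpoly set \<Rightarrow> ('v, 'k) mpoly set \<Rightarrow> bool" where
  "basis_modulo I V B \<longleftrightarrow>
     finite B \<and> B \<subseteq> V \<and>
     (\<forall>c. (\<Sum>b\<in>B. smult_mpoly (c b) b) \<in> I \<longrightarrow> (\<forall>b\<in>B. c b = 0)) \<and>
     (\<forall>f\<in>V. \<exists>c. f - (\<Sum>b\<in>B. smult_mpoly (c b) b) \<in> I)"

text \<open>The dimension of the degree \<open>i\<close> component of the quotient of the polynomial ring by \<open>I\<close>;
  see \<open>hilbert_fun_eq_diff\<close> for the expression as a difference of dimensions.\<close>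

definition hilbert_fun :: "('v::finite, 'k::field) mpoly set \<Rightarrow> nat \<Rightarrow> nat" where
  "hilbert_fun I i = (THE d. \<exists>B. basis_modulo I (forms i) B \<and> card B = d)"

definition reg_index :: "('v::finite, 'k::field) fat_points \<Rightarrow> nat" where
  "reg_index W = (LEAST i. hilbert_fun (fat_ideal W) i = fat_degree W)"


section \<open>Well-definedness of the Hilbert function\<close>

lemma lookup_smult_mpoly [simp]:
  "Poly_Mapping.lookup (smult_mpoly c f) t = c * Poly_Mapping.lookup f t"
proof -
  have "smult_mpoly c f = Poly_Mapping.map ((*) c) f"
    by (simp add: smult_mpoly_def mult_map_scale_conv_mult)
  then show ?thesis
    by (simp add: Poly_Mapping.map.rep_eq when_def)
qed

lemma forms_iff:
  "f \<in> forms i \<longleftrightarrow>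
     (\<forall>t. Poly_Mapping.lookup f t \<noteq> 0 \<longrightarrow> (\<Sum>v\<in>UNIV. Poly_Mapping.lookup t v) = i)"
  by (auto simp: forms_def in_keys_iff)

lemma forms_subspace: "mpoly_vs.subspace (forms i)"
  unfolding mpoly_vs.subspace_def by (auto simp: forms_iff lookup_add) (metis add_0)

lemma finite_exponents: "finite {t :: 'v::finite \<Rightarrow>\<^sub>0 nat. (\<Sum>v\<in>UNIV. Poly_Mapping.lookup t v) = i}"
proof (rule finite_imageD[where f = Poly_Mapping.lookup])
  have "Poly_Mapping.lookup t v \<le> i"
    if "(\<Sum>v\<in>UNIV. Poly_Mapping.lookup t v) = i" for t :: "'v \<Rightarrow>\<^sub>0 nat" and v
    using member_le_sum[of v UNIV "Poly_Mapping.lookup t"] that by simp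
  then have "Poly_Mapping.lookup ` {t :: 'v \<Rightarrow>\<^sub>0 nat. (\<Sum>v\<in>UNIV. Poly_Mapping.lookup t v) = i}
      \<subseteq> Pi\<^sub>E UNIV (\<lambda>_. {..i})"
    by (fastforce simp: PiE_UNIV_domain)
  then show "finite (Poly_Mapping.lookup ` {t :: 'v \<Rightarrow>\<^sub>0 nat. (\<Sum>v\<in>UNIV. Poly_Mapping.lookup t v) = i})"
    by (rule finite_subset) (simp add: finite_PiE)
qed (auto simp: inj_on_def intro: poly_mapping_eqI)

lemma forms_finite_span:
  "\<exists>S. finite S \<and> (forms i :: ('v::finite, 'k::field) mpoly set) \<subseteq> mpoly_vs.span S"
proof (intro exI conjI subsetI)
  let ?T = "{t :: 'v \<Rightarrow>\<^sub>0 nat. (\<Sum>v\<in>UNIV. Poly_Mapping.lookup t v) = i}"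
  let ?S = "(\<lambda>t. Poly_Mapping.single t (1 :: 'k)) ` ?T"
  show "finite ?S"
    by (simp add: finite_exponents)
  fix f :: "('v, 'k) mpoly" assume f: "f \<in> forms i"
  have "f = (\<Sum>t\<in>?T. smult_mpoly (Poly_Mapping.lookup f t) (Poly_Mapping.single t 1))"
  proof (rule poly_mapping_eqI)
    fix u
    have "Poly_Mapping.lookup
        (\<Sum>t\<in>?T. smult_mpoly (Poly_Mapping.lookup f t) (Poly_Mapping.single t 1)) u
      = (\<Sum>t\<in>?T. if t = u then Poly_Mapping.lookup f t else 0)"
      unfolding lookup_sum by (intro sum.cong) (auto simp: lookup_single when_def)
    also have "\<dots> = (if u \<in> ?T then Poly_Mapping.lookup f u else 0)"
      by (rule sum.delta[OF finite_exponents])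
    also have "\<dots> = Poly_Mapping.lookup f u"
      using f by (auto simp: forms_iff)
    finally show "Poly_Mapping.lookup f u = Poly_Mapping.lookup
        (\<Sum>t\<in>?T. smult_mpoly (Poly_Mapping.lookup f t) (Poly_Mapping.single t 1)) u" ..
  qed
  also have "\<dots> \<in> mpoly_vs.span ?S"
    by (intro mpoly_vs.span_sum mpoly_vs.span_scale mpoly_vs.span_base) auto
  finally show "f \<in> mpoly_vs.span ?S" .
qed

lemma ideal_imp_subspace: "ideal.subspace I \<Longrightarrow> mpoly_vs.subspace I"
  unfolding ideal.subspace_def mpoly_vs.subspace_def by (auto simp: smult_mpoly_def)

lemma basis_modulo_exists_card:
  fixes I V :: "('v::finite, 'k::field) mpoly set"
  assumes I: "mpoly_vs.subspace I" and V: "mpoly_vs.subspace V"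
    and fin: "finite S" "V \<subseteq> mpoly_vs.span S"
  shows "\<exists>B. basis_modulo I V B"
    and "basis_modulo I V B \<Longrightarrow> card B = mpoly_vs.dim V - mpoly_vs.dim (V \<inter> I)"
proof -
  have VI: "mpoly_vs.subspace (V \<inter> I)"
    using V I by (rule mpoly_vs.subspace_inter)
  obtain C where C: "C \<subseteq> V \<inter> I" "mpoly_vs.independent C" "V \<inter> I \<subseteq> mpoly_vs.span C"
      "card C = mpoly_vs.dim (V \<inter> I)"
    by (rule mpoly_vs.basis_exists)
  have finC: "finite C"
    using mpoly_vs.independent_span_bound[OF fin(1) C(2)] C(1) fin(2) by blast
  have spanC: "mpoly_vs.span C \<subseteq> V \<inter> I"
    by (rule mpoly_vs.span_minimal[OF C(1) VI])
  obtain D where D: "C \<subseteq> D" "D \<subseteq> V" "mpoly_vs.independent D" "V \<subseteq> mpoly_vs.span D"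
    using mpoly_vs.maximal_independent_subset_extend[of C V] C by blast
  have finD: "finite D"
    using mpoly_vs.independent_span_bound[OF fin(1) D(3)] D(2) fin(2) by blast
  have "basis_modulo I V (D - C)"
    unfolding basis_modulo_def
  proof (intro conjI allI impI ballI)
    fix c b
    assume "(\<Sum>b\<in>D - C. smult_mpoly (c b) b) \<in> I" and b: "b \<in> D - C"
    moreover have "(\<Sum>b\<in>D - C. smult_mpoly (c b) b) \<in> V"
      using D(2) by (intro mpoly_vs.subspace_sum V mpoly_vs.subspace_scale) auto
    ultimately have "(\<Sum>b\<in>D - C. smult_mpoly (c b) b) \<in> mpoly_vs.span C"
      using C(3) by blast
    then obtain e where e: "(\<Sum>b\<in>D - C. smult_mpoly (c b) b) = (\<Sum>b\<in>C. smult_mpoly (e b) b)"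
      unfolding mpoly_vs.span_finite[OF finC] by auto
    define h where "h x = (if x \<in> C then - e x else c x)" for x
    have "(\<Sum>x\<in>D. smult_mpoly (h x) x)
        = (\<Sum>x\<in>D - C. smult_mpoly (h x) x) + (\<Sum>x\<in>C. smult_mpoly (h x) x)"
      by (rule sum.subset_diff[OF D(1) finD])
    also have "\<dots> = (\<Sum>x\<in>D - C. smult_mpoly (c x) x) - (\<Sum>x\<in>C. smult_mpoly (e x) x)"
      by (simp add: h_def sum_negf)
    finally have "(\<Sum>x\<in>D. smult_mpoly (h x) x) = 0"
      using e by simp
    from mpoly_vs.independentD[OF D(3) finD subset_refl this] have "h b = 0"
      using b by simp
    then show "c b = 0"
      using b by (simp add: h_def)
  next
    fix f assume "f \<in> V"
    then obtain c where c: "f = (\<Sum>x\<in>D. smult_mpoly (c x) x)"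
      using D(4) unfolding mpoly_vs.span_finite[OF finD] by auto
    have "f = (\<Sum>x\<in>D - C. smult_mpoly (c x) x) + (\<Sum>x\<in>C. smult_mpoly (c x) x)"
      unfolding c by (rule sum.subset_diff[OF D(1) finD])
    moreover have "(\<Sum>x\<in>C. smult_mpoly (c x) x) \<in> I"
      using C(1) by (intro mpoly_vs.subspace_sum I mpoly_vs.subspace_scale) auto
    ultimately show "\<exists>c. f - (\<Sum>b\<in>D - C. smult_mpoly (c b) b) \<in> I"
      by (intro exI[of _ c]) (simp add: algebra_simps)
  qed (use D finD in auto)
  then show "\<exists>B. basis_modulo I V B" ..

  assume "basis_modulo I V B"
  then have B: "finite B" "B \<subseteq> V"
      "\<And>c b. (\<Sum>b\<in>B. smult_mpoly (c b) b) \<in> I \<Longrightarrow> b \<in> B \<Longrightarrow> c b = 0"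
      "\<And>f. f \<in> V \<Longrightarrow> \<exists>c. f - (\<Sum>b\<in>B. smult_mpoly (c b) b) \<in> I"
    unfolding basis_modulo_def by simp_all
  have disj: "B \<inter> C = {}"
  proof (rule ccontr)
    assume "B \<inter> C \<noteq> {}"
    then obtain b where b: "b \<in> B" "b \<in> C" by blast
    have "(\<Sum>x\<in>B. smult_mpoly (if x = b then 1 else 0) x) = (\<Sum>x\<in>B. if x = b then x else 0)"
      by (intro sum.cong) auto
    also have "\<dots> = b"
      using B(1) b(1) by simp
    finally have "(\<Sum>x\<in>B. smult_mpoly (if x = b then 1 else 0) x) \<in> I"
      using b C(1) by auto
    from B(3)[OF this b(1)] show False by simp
  qed
  have fBC: "finite (B \<union> C)"
    using B(1) finC by simp
  have "mpoly_vs.independent (B \<union> C)"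
    unfolding mpoly_vs.dependent_finite[OF fBC]
  proof (clarify)
    fix h v assume v: "v \<in> B \<union> C" "h v \<noteq> 0" and 0: "(\<Sum>v\<in>B \<union> C. smult_mpoly (h v) v) = 0"
    have split: "(\<Sum>v\<in>B. smult_mpoly (h v) v) + (\<Sum>v\<in>C. smult_mpoly (h v) v) = 0"
      unfolding sum.union_disjoint[OF B(1) finC disj, symmetric] by (rule 0)
    have "(\<Sum>v\<in>C. smult_mpoly (h v) v) \<in> I"
      using C(1) by (intro mpoly_vs.subspace_sum I mpoly_vs.subspace_scale) auto
    from mpoly_vs.subspace_neg[OF I this] have "(\<Sum>v\<in>B. smult_mpoly (h v) v) \<in> I"
      unfolding eq_neg_iff_add_eq_0[THEN iffD2, OF split] .
    then have hB: "\<And>b. b \<in> B \<Longrightarrow> h b = 0"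
      by (rule B(3))
    then have "(\<Sum>v\<in>C. smult_mpoly (h v) v) = 0"
      using split by simp
    from mpoly_vs.independentD[OF C(2) finC subset_refl this] hB v show False
      by blast
  qed
  moreover have "V \<subseteq> mpoly_vs.span (B \<union> C)"
  proof
    fix f assume f: "f \<in> V"
    from B(4)[OF this] obtain c where c: "f - (\<Sum>b\<in>B. smult_mpoly (c b) b) \<in> I" ..
    have "(\<Sum>b\<in>B. smult_mpoly (c b) b) \<in> V"
      using B(2) by (intro mpoly_vs.subspace_sum V mpoly_vs.subspace_scale) auto
    with c f have "f - (\<Sum>b\<in>B. smult_mpoly (c b) b) \<in> mpoly_vs.span C"
      using C(3) mpoly_vs.subspace_diff[OF V] by blast
    then have "f - (\<Sum>b\<in>B. smult_mpoly (c b) b) \<in> mpoly_vs.span (B \<union> C)"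
      using mpoly_vs.span_mono[of C "B \<union> C"] by blast
    moreover have "(\<Sum>b\<in>B. smult_mpoly (c b) b) \<in> mpoly_vs.span (B \<union> C)"
      by (intro mpoly_vs.span_sum mpoly_vs.span_scale mpoly_vs.span_base) auto
    ultimately show "f \<in> mpoly_vs.span (B \<union> C)"
      using mpoly_vs.span_add by fastforce
  qed
  moreover have "B \<union> C \<subseteq> V"
    using B(2) C(1) by blast
  ultimately have "card (B \<union> C) = mpoly_vs.dim V"
    by (intro mpoly_vs.basis_card_eq_dim)
  then show "card B = mpoly_vs.dim V - mpoly_vs.dim (V \<inter> I)"
    using card_Un_disjoint[OF B(1) finC disj] C(4) by simp
qed

lemma hilbert_fun_eq_diff:
  fixes I :: "('v::finite, 'k::field) mpoly set"
  assumes "ideal.subspace I"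
  shows "hilbert_fun I i = mpoly_vs.dim (forms i :: ('v, 'k) mpoly set) - mpoly_vs.dim (forms i \<inter> I)"
proof -
  obtain S where "finite S" "(forms i :: ('v, 'k) mpoly set) \<subseteq> mpoly_vs.span S"
    using forms_finite_span by blast
  note * = basis_modulo_exists_card[OF ideal_imp_subspace[OF assms] forms_subspace this]
  show ?thesis
    unfolding hilbert_fun_def using * by (intro the_equality) blast+
qed

lemma ideal_fat_ideal: "ideal.subspace (fat_ideal W)"
proof -
  have "ideal.subspace (ideal_pow J m)" for J :: "('a, 'b) mpoly set" and m
    by (cases m) auto
  then show ?thesis
    unfolding fat_ideal_def by (intro ideal.subspace_Inter) auto
qed

end

theory Submission
  imports Defs "HOL-Computational_Algebra.Formal_Power_Series"
begin

text \<open>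
  The subscheme \<open>{X1; m}\<close> of \<open>Y\<close> already forces the bound.  If \<open>X1\<close> is cut out by
  \<open>G_1, ..., G_n\<close> of degrees \<open>e_i\<close>, then the ideal of \<open>{X1; m}\<close> lies in
  \<open>V = (G_1, ..., G_{n-1}, G_n^m)\<close>, since it agrees locally with \<open>(G_1, ..., G_n)^m\<close> and a form \<open>s\<close>
  vanishing at no point of \<open>X1\<close> is a nonzerodivisor modulo \<open>V\<close>.
  Let \<open>s\<close> have degree \<open>D \<ge> 1\<close> and vanish at no point of \<open>X\<close>.  If the Hilbert function of \<open>Y\<close> takes
  the value \<open>deg Y\<close> at \<open>i\<close>, then it does so at \<open>i + D\<close>, so that every form of degree \<open>i + D\<close> lies in
  \<open>I_Y + (s)\<close> and hence in \<open>V + (s)\<close>.  But \<open>V + (s)\<close> is generated by a regular sequence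
  of \<open>n + 1\<close> forms, so its Hilbert series is the product of the geometric sums \<open>1 + t + ... + t^{c-1}\<close>
  over their degrees \<open>c\<close>, all of whose coefficients up to degree \<open>\<Sum>(c - 1)\<close> are positive; hence
  \<open>i + D > \<Sum>(c - 1)\<close>.
\<close>

section \<open>Homogeneous components\<close>

definition mdeg :: "('v::finite \<Rightarrow>\<^sub>0 nat) \<Rightarrow> nat" where
  "mdeg t = (\<Sum>v\<in>UNIV. Poly_Mapping.lookup t v)"

lemma mdeg_add: "mdeg (s + t) = mdeg s + mdeg t"
  by (simp add: mdeg_def lookup_add sum.distrib)

lemma mdeg_single [simp]: "mdeg (Poly_Mapping.single v k) = k"
  by (simp add: mdeg_def lookup_single when_def)

lemma forms_iff_mdeg: "f \<in> forms i \<longleftrightarrow> (\<forall>t. Poly_Mapping.lookup f t \<noteq> 0 \<longrightarrow> mdeg t = i)"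
  by (simp add: forms_iff mdeg_def)

lemma finite_mdeg: "finite {t :: 'v::finite \<Rightarrow>\<^sub>0 nat. mdeg t = i}"
  unfolding mdeg_def by (rule finite_exponents)

lemma forms_0 [simp]: "0 \<in> forms i"
  by (simp add: forms_iff)

lemma forms_add: "f \<in> forms i \<Longrightarrow> g \<in> forms i \<Longrightarrow> f + g \<in> forms i"
  using forms_subspace mpoly_vs.subspace_add by blast

lemma forms_diff: "f \<in> forms i \<Longrightarrow> g \<in> forms i \<Longrightarrow> f - g \<in> forms i"
  using forms_subspace mpoly_vs.subspace_diff by blast

lemma forms_sum: "(\<And>x. x \<in> A \<Longrightarrow> f x \<in> forms i) \<Longrightarrow> sum f A \<in> forms i"
  by (induction A rule: infinite_finite_induct) (auto intro: forms_add)

lemma forms_mult: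
  fixes f g :: "('v::finite, 'k::field) mpoly"
  assumes "f \<in> forms i" and "g \<in> forms j"
  shows "f * g \<in> forms (i + j)"
  unfolding forms_iff_mdeg
proof (intro allI impI)
  fix t assume "Poly_Mapping.lookup (f * g) t \<noteq> 0"
  then obtain a b where "a \<in> Poly_Mapping.keys f" "b \<in> Poly_Mapping.keys g" "t = a + b"
    using keys_mult[of f g] by (auto simp: in_keys_iff)
  then show "mdeg t = i + j"
    using assms by (auto simp: mdeg_add forms_iff_mdeg in_keys_iff)
qed

lemma forms_single: "mdeg t = i \<Longrightarrow> Poly_Mapping.single t c \<in> forms i"
  by (auto simp: forms_iff_mdeg lookup_single when_def)

lemma forms_one: "1 \<in> forms 0"
  using forms_single[of 0 0 1] by (simp add: mdeg_def)

lemma forms_power: "f \<in> forms i \<Longrightarrow> f ^ k \<in> forms (k * i)"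
  by (induction k) (auto simp: forms_one intro: forms_mult)

lemma forms_prod: "(\<And>x. x \<in> A \<Longrightarrow> f x \<in> forms (e x)) \<Longrightarrow> prod f A \<in> forms (sum e A)"
  by (induction A rule: infinite_finite_induct) (auto simp: forms_one intro: forms_mult)

lemma forms_smult: "f \<in> forms i \<Longrightarrow> smult_mpoly c f \<in> forms i"
  by (simp add: forms_iff_mdeg)

lemma mpoly_eq_sum_single:
  "(f :: ('v::finite, 'k::field) mpoly)
    = (\<Sum>t\<in>Poly_Mapping.keys f. Poly_Mapping.single t (Poly_Mapping.lookup f t))"
  by (rule poly_mapping_eqI)
    (simp add: lookup_sum lookup_single when_def in_keys_iff sum.delta')

definition hcomp :: "nat \<Rightarrow> ('v::finite, 'k::field) mpoly \<Rightarrow> ('v, 'k) mpoly" where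
  "hcomp i f = Abs_poly_mapping (\<lambda>t. if mdeg t = i then Poly_Mapping.lookup f t else 0)"

lemma lookup_hcomp [simp]:
  "Poly_Mapping.lookup (hcomp i f) t = (if mdeg t = i then Poly_Mapping.lookup f t else 0)"
  unfolding hcomp_def
  by (subst lookup_Abs_poly_mapping)
    (auto intro: finite_subset[OF _ finite_keys[of f]] simp: in_keys_iff)

lemma hcomp_forms: "hcomp i f \<in> forms i"
  by (simp add: forms_iff_mdeg)

lemma hcomp_form: "f \<in> forms j \<Longrightarrow> hcomp i f = (if i = j then f else 0)"
  by (intro poly_mapping_eqI) (auto simp: forms_iff_mdeg)

lemma hcomp_zero [simp]: "hcomp i 0 = 0"
  by (rule poly_mapping_eqI) simp

lemma hcomp_add: "hcomp i (f + g) = hcomp i f + hcomp i g"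
  by (rule poly_mapping_eqI) (simp add: lookup_add)

lemma hcomp_diff: "hcomp i (f - g) = hcomp i f - hcomp i g"
  by (rule poly_mapping_eqI) (simp add: lookup_minus)

lemma hcomp_sum: "hcomp i (sum f A) = (\<Sum>x\<in>A. hcomp i (f x))"
  by (induction A rule: infinite_finite_induct) (auto simp: hcomp_add)

lemma sum_hcomp:
  fixes f :: "('v::finite, 'k::field) mpoly"
  obtains N where "f = (\<Sum>i\<le>N. hcomp i f)"
proof
  \<comment> \<open>For \<open>f = 0\<close> this \<open>Max\<close> is taken over the empty set and
    its value is arbitrary; any cutoff works then, since all components are 0.\<close>
  show "f = (\<Sum>i\<le>Max (mdeg ` Poly_Mapping.keys f). hcomp i f)"
  proof (rule poly_mapping_eqI)
    fix t
    show "Poly_Mapping.lookup f t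
        = Poly_Mapping.lookup (\<Sum>i\<le>Max (mdeg ` Poly_Mapping.keys f). hcomp i f) t"
    proof (cases "t \<in> Poly_Mapping.keys f")
      case True
      then have "mdeg t \<le> Max (mdeg ` Poly_Mapping.keys f)"
        by (intro Max_ge) auto
      then show ?thesis
        by (simp add: lookup_sum)
    qed (simp add: lookup_sum in_keys_iff)
  qed
qed

text \<open>With \<open>g\<close> written as the sum of its components, each summand
  \<open>hcomp i g * f\<close> is a form of degree \<open>i + d\<close>: multiplication by
  \<open>f\<close> shifts the grading by \<open>d\<close>.\<close>

lemma hcomp_mult_form:
  fixes f g :: "('v::finite, 'k::field) mpoly"
  assumes f: "f \<in> forms d"
  shows "hcomp (i + d) (g * f) = hcomp i g * f" and "j < d \<Longrightarrow> hcomp j (g * f) = 0"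
proof -
  obtain N where N: "g = (\<Sum>i\<le>N. hcomp i g)"
    by (rule sum_hcomp)
  obtain h where h: "h = (\<lambda>i. hcomp i g)" by blast
  have gf: "g * f = (\<Sum>i\<le>N. h i * f)"
    using arg_cong[OF N, of "\<lambda>x. x * f"] by (simp only: h sum_distrib_right)
  have *: "hcomp j (h i * f) = (if j = i + d then h i * f else 0)" for i j
    unfolding h by (rule hcomp_form[OF forms_mult[OF hcomp_forms f]])
  \<comment> \<open>Components beyond the cutoff \<open>N\<close> are 0, so the formula also holds
    for \<open>i > N\<close>, where the sum has no matching term.\<close>
  have h0: "h i = 0" if "\<not> i \<le> N"
  proof -
    have "hcomp i g = (\<Sum>j\<le>N. hcomp i (h j))"
      using arg_cong[OF N, of "hcomp i"] by (simp only: h hcomp_sum)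
    also have "\<dots> = 0"
      using that by (intro sum.neutral) (auto simp: h hcomp_form[OF hcomp_forms])
    finally show ?thesis by (simp add: h)
  qed
  show "hcomp (i + d) (g * f) = hcomp i g * f"
  proof -
    have "(\<Sum>j\<le>N. if i + d = j + d then h j * f else 0) = h i * f"
      using h0 by (simp add: sum.delta')
    then show ?thesis
      unfolding gf hcomp_sum * by (simp add: h)
  qed
  show "hcomp j (g * f) = 0" if "j < d"
    unfolding gf hcomp_sum * using that by (intro sum.neutral) auto
qed

definition homogeneous_ideal :: "('v::finite, 'k::field) mpoly set \<Rightarrow> bool" where
  "homogeneous_ideal I \<longleftrightarrow> ideal.subspace I \<and> (\<forall>f\<in>I. \<forall>i. hcomp i f \<in> I)"

lemma homogeneous_ideal_subspace: "homogeneous_ideal I \<Longrightarrow> ideal.subspace I"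
  by (simp add: homogeneous_ideal_def)

text \<open>The generators need not be forms; it suffices that their components stay in the span.
  For a multiple \<open>c * x\<close>, splitting \<open>x\<close> into components leaves the
  products \<open>hcomp (i - l) c * hcomp l x\<close> in degree \<open>i\<close>, which are
  multiples of those.\<close>

lemma homogeneous_span:
  fixes S :: "('v::finite, 'k::field) mpoly set"
  assumes "\<And>f i. f \<in> S \<Longrightarrow> hcomp i f \<in> ideal.span S"
  shows "homogeneous_ideal (ideal.span S)"
  unfolding homogeneous_ideal_def
proof (intro conjI ballI allI)
  fix f i assume "f \<in> ideal.span S"
  then show "hcomp i f \<in> ideal.span S"
  proof (induction rule: ideal.span_induct_alt)
    case (step c x y)
    obtain M where M: "x = (\<Sum>j\<le>M. hcomp j x)"
      by (rule sum_hcomp)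
    have "c * x = (\<Sum>l\<le>M. c * hcomp l x)"
      using arg_cong[OF M, of "\<lambda>x. c * x"] by (simp only: sum_distrib_left)
    then have "hcomp i (c * x) = (\<Sum>l\<le>M. hcomp i (c * hcomp l x))"
      by (simp add: hcomp_sum)
    also have "\<dots> \<in> ideal.span S"
    proof (rule ideal.span_sum)
      fix l
      show "hcomp i (c * hcomp l x) \<in> ideal.span S"
      proof (cases "i < l")
        case True
        then show ?thesis
          by (simp add: hcomp_mult_form(2)[OF hcomp_forms] ideal.span_zero)
      next
        case False
        then have "hcomp i (c * hcomp l x) = hcomp (i - l) c * hcomp l x"
          using hcomp_mult_form(1)[where d = l and f = "hcomp l x" and g = c and i = "i - l", OF hcomp_forms] by simp
        then show ?thesis
          using ideal.span_scale[OF assms[OF step.hyps(1)]] by simp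
      qed
    qed
    finally show ?case
      using step by (simp add: hcomp_add ideal.span_add)
  qed (simp add: ideal.span_zero)
qed simp

lemma homogeneous_span_forms:
  assumes "\<And>f. f \<in> S \<Longrightarrow> \<exists>i. f \<in> forms i"
  shows "homogeneous_ideal (ideal.span S)"
proof (rule homogeneous_span)
  fix f i assume f: "f \<in> S"
  then obtain j where "f \<in> forms j" using assms by blast
  then show "hcomp i f \<in> ideal.span S"
    using f by (auto simp: hcomp_form intro: ideal.span_base ideal.span_zero)
qed

lemma homogeneous_span_insert:
  assumes "homogeneous_ideal I" and "f \<in> forms d"
  shows "homogeneous_ideal (ideal.span (insert f I))"
  using assms by (intro homogeneous_span)
    (auto simp: homogeneous_ideal_def hcomp_form intro: ideal.span_base ideal.span_zero)

lemma homogeneous_INT: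
  assumes "\<And>x. x \<in> A \<Longrightarrow> homogeneous_ideal (I x)"
  shows "homogeneous_ideal (\<Inter>x\<in>A. I x)"
  using assms by (auto simp: homogeneous_ideal_def intro!: ideal.subspace_Int)

text \<open>In a product \<open>a * b\<close> only the first factor has to be split: the degree
  \<open>i\<close> part of \<open>hcomp l a * b\<close> is
  \<open>hcomp l a * hcomp (i - l) b\<close>, again a product of the defining shape by the induction
  hypothesis.\<close>

lemma homogeneous_ideal_pow:
  fixes I :: "('v::finite, 'k::field) mpoly set"
  assumes "homogeneous_ideal I"
  shows "homogeneous_ideal (ideal_pow I m)"
proof (induction m)
  case 0
  then show ?case by (simp add: homogeneous_ideal_def)
next
  case (Suc m)
  show ?case
    unfolding ideal_pow.simps
  proof (rule homogeneous_span)
    fix f i assume "f \<in> {a * b |a b. a \<in> I \<and> b \<in> ideal_pow I m}"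
    then obtain a b where f: "f = a * b" "a \<in> I" "b \<in> ideal_pow I m" by blast
    obtain N where N: "a = (\<Sum>j\<le>N. hcomp j a)"
      by (rule sum_hcomp)
    have "f = (\<Sum>j\<le>N. b * hcomp j a)"
      using arg_cong[OF N, of "\<lambda>x. b * x"] by (simp only: f(1) sum_distrib_left mult.commute)
    then have "hcomp i f = (\<Sum>l\<le>N. hcomp i (b * hcomp l a))"
      by (simp add: hcomp_sum)
    also have "\<dots> \<in> ideal.span {a * b |a b. a \<in> I \<and> b \<in> ideal_pow I m}"
    proof (rule ideal.span_sum)
      fix l
      show "hcomp i (b * hcomp l a) \<in> ideal.span {a * b |a b. a \<in> I \<and> b \<in> ideal_pow I m}"
      proof (cases "i < l")
        case True
        then show ?thesis
          by (simp add: hcomp_mult_form(2)[OF hcomp_forms] ideal.span_zero)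
      next
        case False
        then have "hcomp i (b * hcomp l a) = hcomp l a * hcomp (i - l) b"
          using hcomp_mult_form(1)[where d = l and f = "hcomp l a" and g = b and i = "i - l", OF hcomp_forms] by (simp add: mult.commute)
        then show ?thesis
          using f Suc assms unfolding homogeneous_ideal_def by (intro ideal.span_base) blast
      qed
    qed
    finally show "hcomp i f \<in> ideal.span {a * b |a b. a \<in> I \<and> b \<in> ideal_pow I m}" .
  qed
qed

section \<open>Substitution\<close>

text \<open>Covers at once evaluation at a vector, where \<open>c\<close> is the identity of the
  field, and substitution of polynomials for the variables, where \<open>c\<close> embeds the
  constants.\<close>

locale coeff_hom =
  fixes c :: "'k::field \<Rightarrow> 'a::comm_ring_1"
  assumes add: "c (x + y) = c x + c y" and mult: "c (x * y) = c x * c y" and one: "c 1 = 1"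
begin

lemma zero: "c 0 = 0"
  using add[of 0 0] by simp

definition psubst :: "('v::finite \<Rightarrow> 'a) \<Rightarrow> ('v, 'k) mpoly \<Rightarrow> 'a" where
  "psubst g f = (\<Sum>t\<in>Poly_Mapping.keys f.
     c (Poly_Mapping.lookup f t) * (\<Prod>v\<in>UNIV. g v ^ Poly_Mapping.lookup t v))"

text \<open>Cancellation can shrink the support of a sum, so additivity is checked over a common
  larger set of exponents, where the extra coefficients are 0.\<close>

lemma psubst_superset:
  assumes "finite A" and "Poly_Mapping.keys f \<subseteq> A"
  shows "psubst g f = (\<Sum>t\<in>A. c (Poly_Mapping.lookup f t) * (\<Prod>v\<in>UNIV. g v ^ Poly_Mapping.lookup t v))"
  unfolding psubst_def using assms by (intro sum.mono_neutral_left) (auto simp: in_keys_iff zero)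

lemma psubst_zero [simp]: "psubst g 0 = 0"
  by (simp add: psubst_def)

lemma psubst_single:
  "psubst g (Poly_Mapping.single t a) = c a * (\<Prod>v\<in>UNIV. g v ^ Poly_Mapping.lookup t v)"
  by (subst psubst_superset[of "{t}"]) auto

lemma psubst_add: "psubst g (f + h) = psubst g f + psubst g h"
proof -
  let ?A = "Poly_Mapping.keys f \<union> Poly_Mapping.keys h"
  have "Poly_Mapping.keys (f + h) \<subseteq> ?A" by (rule keys_add)
  then show ?thesis
    by (simp add: psubst_superset[of ?A] lookup_add add distrib_right sum.distrib)
qed

lemma psubst_diff: "psubst g (f - h) = psubst g f - psubst g h"
  using psubst_add[of g "f - h" h] by simp

lemma psubst_sum: "psubst g (sum f A) = (\<Sum>x\<in>A. psubst g (f x))"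
  by (induction A rule: infinite_finite_induct) (auto simp: psubst_add)

lemma psubst_mult: "psubst g (f * h) = psubst g f * psubst g h"
proof -
  let ?s = "\<lambda>f t. Poly_Mapping.single t (Poly_Mapping.lookup f t)"
  have *: "psubst g (?s f t * ?s h u) = psubst g (?s f t) * psubst g (?s h u)" for t u
    unfolding mult_single psubst_single mult lookup_add power_add prod.distrib
    by (simp only: ac_simps)
  have "f * h = (\<Sum>t\<in>Poly_Mapping.keys f. \<Sum>u\<in>Poly_Mapping.keys h. ?s f t * ?s h u)"
    using arg_cong2[OF mpoly_eq_sum_single[of f] mpoly_eq_sum_single[of h], of "(*)"]
    by (simp only: sum_product)
  then have "psubst g (f * h)
      = (\<Sum>t\<in>Poly_Mapping.keys f. \<Sum>u\<in>Poly_Mapping.keys h. psubst g (?s f t) * psubst g (?s h u))"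
    by (simp only: psubst_sum *)
  also have "\<dots> = psubst g f * psubst g h"
    by (simp only: psubst_def[of g f] psubst_def[of g h] psubst_single sum_product)
  finally show ?thesis .
qed

lemma psubst_one [simp]: "psubst g 1 = 1"
  using psubst_single[of g 0 1] by (simp add: one)

lemma psubst_power: "psubst g (f ^ n) = psubst g f ^ n"
  by (induction n) (simp_all add: psubst_mult)

lemma psubst_prod: "psubst g (prod f A) = (\<Prod>x\<in>A. psubst g (f x))"
  by (induction A rule: infinite_finite_induct) (auto simp: psubst_mult)

end

interpretation eval: coeff_hom "\<lambda>x :: 'k::field. x"
  rewrites "coeff_hom.psubst (\<lambda>x :: 'k. x) = (\<lambda>x f. eval_mpoly f (x :: 'v::finite \<Rightarrow> 'k))"
proof -
  show "coeff_hom (\<lambda>x :: 'k::field. x)" by unfold_locales auto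
  then show "coeff_hom.psubst (\<lambda>x :: 'k. x) = (\<lambda>x f. eval_mpoly f (x :: 'v::finite \<Rightarrow> 'k))"
    by (simp add: fun_eq_iff coeff_hom.psubst_def eval_mpoly_def)
qed

interpretation csubst: coeff_hom "Poly_Mapping.single 0 :: 'k::field \<Rightarrow> ('v::finite, 'k) mpoly"
  by unfold_locales (simp_all add: single_add mult_single)

abbreviation csubst :: "('v::finite \<Rightarrow> ('v, 'k::field) mpoly) \<Rightarrow> ('v, 'k) mpoly \<Rightarrow> ('v, 'k) mpoly"
  where "csubst \<equiv> csubst.psubst"

section \<open>Variables and composition of substitutions\<close>

definition Var :: "'v::finite \<Rightarrow> ('v, 'k::field) mpoly" where
  "Var v = Poly_Mapping.single (Poly_Mapping.single v 1) 1"

lemma Var_forms: "Var v \<in> forms 1"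
  unfolding Var_def by (rule forms_single) simp

lemma Var_power: "Var v ^ k = Poly_Mapping.single (Poly_Mapping.single v k) 1"
  by (induction k) (simp_all add: Var_def mult_single flip: single_add)

lemma single_eq_prod_Var:
  "Poly_Mapping.single t (a :: 'k::field) = Poly_Mapping.single 0 a * (\<Prod>v\<in>UNIV. Var v ^ Poly_Mapping.lookup t v)"
proof -
  have "(\<Prod>v\<in>A. Poly_Mapping.single (Poly_Mapping.single v (Poly_Mapping.lookup t v)) (1::'k))
      = Poly_Mapping.single (\<Sum>v\<in>A. Poly_Mapping.single v (Poly_Mapping.lookup t v)) 1" for A
    by (induction A rule: infinite_finite_induct) (simp_all add: mult_single)
  moreover have "(\<Sum>v\<in>UNIV. Poly_Mapping.single v (Poly_Mapping.lookup t v)) = t"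
    by (rule poly_mapping_eqI) (simp add: lookup_sum lookup_single when_def)
  ultimately show ?thesis
    by (simp add: Var_power mult_single)
qed

lemma prod_single_one [simp]:
  "(\<Prod>w\<in>UNIV. f w ^ Poly_Mapping.lookup (Poly_Mapping.single v (Suc 0)) w) = (f (v::'v::finite) :: 'a::comm_monoid_mult)"
proof -
  have "(\<Prod>w\<in>UNIV. f w ^ Poly_Mapping.lookup (Poly_Mapping.single v (Suc 0)) w)
      = (\<Prod>w\<in>UNIV. if w = v then f w else 1)"
    by (intro prod.cong) (auto simp: lookup_single when_def)
  then show ?thesis by simp
qed

lemma csubst_Var [simp]: "csubst g (Var v) = g v"
  by (simp add: Var_def csubst.psubst_single)

lemma eval_Var [simp]: "eval_mpoly (Var v) x = x v"
  by (simp add: Var_def eval.psubst_single)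

lemma csubst_const [simp]: "csubst g (Poly_Mapping.single 0 a) = Poly_Mapping.single 0 a"
  by (simp add: csubst.psubst_single)

lemma eval_const [simp]: "eval_mpoly (Poly_Mapping.single 0 a) x = a"
  by (simp add: eval.psubst_single)

lemma csubst_smult: "csubst g (smult_mpoly a f) = smult_mpoly a (csubst g f)"
  by (simp add: smult_mpoly_def csubst.psubst_mult)

lemma eval_smult [simp]: "eval_mpoly (smult_mpoly a f) x = a * eval_mpoly f x"
  by (simp add: smult_mpoly_def eval.psubst_mult)

lemma csubst_csubst: "csubst g (csubst h f) = csubst (\<lambda>v. csubst g (h v)) f"
  unfolding csubst.psubst_def[of h f] csubst.psubst_def[of _ f]
  by (simp add: csubst.psubst_sum csubst.psubst_mult csubst.psubst_prod csubst.psubst_power)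

lemma eval_csubst: "eval_mpoly (csubst h f) x = eval_mpoly f (\<lambda>v. eval_mpoly (h v) x)"
  unfolding csubst.psubst_def[of h f] eval_mpoly_def[of f]
  by (simp add: eval.psubst_sum eval.psubst_mult eval.psubst_prod eval.psubst_power)

lemma csubst_id: "csubst Var f = f"
  unfolding csubst.psubst_def single_eq_prod_Var[symmetric] mpoly_eq_sum_single[symmetric] ..

lemma csubst_forms:
  assumes "\<And>v. g v \<in> forms 1" and "f \<in> forms i"
  shows "csubst g f \<in> forms i"
  unfolding csubst.psubst_def
proof (rule forms_sum)
  fix t assume "t \<in> Poly_Mapping.keys f"
  then have "mdeg t = i"
    using assms(2) by (simp add: forms_iff_mdeg in_keys_iff)
  moreover have "(\<Prod>v\<in>UNIV. g v ^ Poly_Mapping.lookup t v) \<in> forms (\<Sum>v\<in>UNIV. Poly_Mapping.lookup t v * 1)"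
    by (intro forms_prod forms_power assms)
  ultimately show "Poly_Mapping.single 0 (Poly_Mapping.lookup f t) * (\<Prod>v\<in>UNIV. g v ^ Poly_Mapping.lookup t v)
      \<in> forms i"
    by (simp add: mdeg_def forms_smult flip: smult_mpoly_def)
qed

lemma eval_scale:
  assumes "f \<in> forms i"
  shows "eval_mpoly f (\<lambda>v. a * x v) = a ^ i * eval_mpoly f x"
proof -
  have "eval_mpoly f (\<lambda>v. a * x v) = (\<Sum>t\<in>Poly_Mapping.keys f.
      a ^ i * (Poly_Mapping.lookup f t * (\<Prod>v\<in>UNIV. x v ^ Poly_Mapping.lookup t v)))"
    unfolding eval_mpoly_def
  proof (rule sum.cong)
    fix t assume "t \<in> Poly_Mapping.keys f"
    then have "(\<Sum>v\<in>UNIV. Poly_Mapping.lookup t v) = i"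
      using assms by (simp add: forms_iff in_keys_iff)
    then show "Poly_Mapping.lookup f t * (\<Prod>v\<in>UNIV. (a * x v) ^ Poly_Mapping.lookup t v)
      = a ^ i * (Poly_Mapping.lookup f t * (\<Prod>v\<in>UNIV. x v ^ Poly_Mapping.lookup t v))"
      by (auto simp: power_mult_distrib prod.distrib power_sum[symmetric])
  qed simp
  then show ?thesis
    by (simp add: eval_mpoly_def sum_distrib_left)
qed

section \<open>Points and their vanishing ideals\<close>

text \<open>Divide by a nonzero coordinate. The coordinate \<open>v\<close> normalised to 1 later
  allows the point to be moved to the coordinate point of \<open>v\<close>.\<close>

lemma proj_space_rep:
  fixes Q :: "('v::finite \<Rightarrow> 'k::field) set"
  assumes "Q \<in> proj_space"
  obtains q v where "q v = 1" and "Q = {\<lambda>w. a * q w |a. a \<noteq> 0}"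
proof -
  obtain x where x: "x \<noteq> (\<lambda>_. 0)" "Q = proj_rel `` {x}"
    using assms by (auto simp: proj_space_def quotient_def)
  then obtain v where v: "x v \<noteq> 0" by auto
  have "Q = {\<lambda>w. a * (x w / x v) |a. a \<noteq> 0}"
  proof (intro set_eqI iffI)
    fix y assume "y \<in> Q"
    then obtain a where a: "a \<noteq> 0" "y = (\<lambda>w. a * x w)"
      by (auto simp: x(2) proj_rel_def)
    then show "y \<in> {\<lambda>w. a * (x w / x v) |a. a \<noteq> 0}"
      using v by (intro CollectI exI[of _ "a * x v"]) auto
  next
    fix y assume "y \<in> {\<lambda>w. a * (x w / x v) |a. a \<noteq> 0}"
    then obtain a where a: "a \<noteq> 0" "y = (\<lambda>w. a * (x w / x v))" by auto
    then show "y \<in> Q"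
      unfolding x(2) proj_rel_def using v x(1)
      by (intro ImageI[of x] CollectI) (auto intro!: exI[of _ "a / x v"])
  qed
  with v show thesis by (intro that[of "\<lambda>w. x w / x v" v]) auto
qed

text \<open>Scaling the coordinates by \<open>a\<close> multiplies a form of degree \<open>i\<close>
  by the nonzero factor \<open>a ^ i\<close>, so one representative decides for the whole
  point.\<close>

lemma form_zero_iff:
  assumes "f \<in> forms i" and "Q = {\<lambda>w. a * q w |a. a \<noteq> (0::'k::field)}"
  shows "(\<forall>x\<in>Q. eval_mpoly f x = 0) \<longleftrightarrow> eval_mpoly f q = 0"
    and "(\<forall>x\<in>Q. eval_mpoly f x \<noteq> 0) \<longleftrightarrow> eval_mpoly f q \<noteq> 0"
proof -
  have "q \<in> Q"
    unfolding assms(2) by (rule CollectI, rule exI[of _ 1]) simp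
  moreover have "\<exists>a. a \<noteq> 0 \<and> eval_mpoly f x = a ^ i * eval_mpoly f q" if "x \<in> Q" for x
    using that eval_scale[OF assms(1), of _ q] unfolding assms(2) by blast
  ultimately show "(\<forall>x\<in>Q. eval_mpoly f x = 0) \<longleftrightarrow> eval_mpoly f q = 0"
    and "(\<forall>x\<in>Q. eval_mpoly f x \<noteq> 0) \<longleftrightarrow> eval_mpoly f q \<noteq> 0"
    by (metis mult_eq_0_iff power_eq_0_iff)+
qed

text \<open>The direction from right to left needs an argument, as \<open>f\<close> may fail to be a
  form. For \<open>x\<close> in a point, the value of \<open>f\<close> at the multiple of
  \<open>x\<close> by \<open>a\<close> is a polynomial in \<open>a\<close> whose coefficients are
  the values of the components at \<open>x\<close>. It vanishes at all nonzero \<open>a\<close>,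
  which are infinitely many in characteristic 0, so every component vanishes at
  \<open>x\<close>.\<close>

lemma vanishing_ideal_iff:
  fixes S :: "('v::finite \<Rightarrow> 'k::field_char_0) set set"
  assumes "S \<subseteq> proj_space"
  shows "f \<in> vanishing_ideal S \<longleftrightarrow> (\<forall>Q\<in>S. \<forall>x\<in>Q. eval_mpoly f x = 0)"
proof
  assume "f \<in> vanishing_ideal S"
  then show "\<forall>Q\<in>S. \<forall>x\<in>Q. eval_mpoly f x = 0"
    unfolding vanishing_ideal_def
    by (induction rule: ideal.span_induct_alt) (auto simp: eval.psubst_add eval.psubst_mult)
next
  assume f: "\<forall>Q\<in>S. \<forall>x\<in>Q. eval_mpoly f x = 0"
  obtain N where N: "f = (\<Sum>i\<le>N. hcomp i f)"
    by (rule sum_hcomp)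
  have "eval_mpoly (hcomp i f) x = 0" if i: "i \<le> N" and Q: "Q \<in> S" "x \<in> Q" for i Q x
  proof -
    obtain q v where q: "Q = {\<lambda>w. a * q w |a. a \<noteq> (0::'k)}"
      using proj_space_rep Q(1) assms by blast
    then obtain b where b: "b \<noteq> 0" "x = (\<lambda>w. b * q w)"
      using Q(2) by blast
    define p where "p = (\<Sum>j\<le>N. monom (eval_mpoly (hcomp j f) x) j)"
    have "poly p a = 0" if "a \<noteq> 0" for a
    proof -
      have "(\<lambda>w. a * x w) \<in> Q"
        unfolding q b using b(1) that by (auto intro!: exI[of _ "a * b"])
      then have "0 = eval_mpoly f (\<lambda>w. a * x w)"
        using f Q by simp
      also have "\<dots> = (\<Sum>j\<le>N. eval_mpoly (hcomp j f) (\<lambda>w. a * x w))"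
        by (subst N) (rule eval.psubst_sum)
      also have "\<dots> = poly p a"
        by (simp add: p_def poly_sum poly_monom eval_scale[OF hcomp_forms])
          (simp add: mult.commute)
      finally show ?thesis ..
    qed
    then have "UNIV - {0} \<subseteq> {a. poly p a = 0}" by auto
    moreover have "infinite (UNIV - {0 :: 'k})"
      by (simp add: infinite_UNIV_char_0)
    ultimately have "p = 0"
      using poly_roots_finite finite_subset by blast
    then have "coeff p i = 0" by simp
    then show ?thesis
      using i by (simp add: p_def coeff_sum)
  qed
  then have "hcomp i f \<in> vanishing_ideal S" if "i \<le> N" for i
    unfolding vanishing_ideal_def using that hcomp_forms by (intro ideal.span_base) blast
  then show "f \<in> vanishing_ideal S"
    by (subst N) (auto simp: vanishing_ideal_def intro: ideal.span_sum)
qed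

lemma homogeneous_vanishing_ideal: "homogeneous_ideal (vanishing_ideal S)"
  unfolding vanishing_ideal_def by (rule homogeneous_span_forms) auto

lemma exists_separating_linear_form:
  fixes Q Q' :: "('v::finite \<Rightarrow> 'k::field) set"
  assumes "Q \<in> proj_space" "Q' \<in> proj_space" "Q \<noteq> Q'"
  obtains l where "l \<in> forms 1" and "\<And>x. x \<in> Q \<Longrightarrow> eval_mpoly l x \<noteq> 0"
    and "\<And>x. x \<in> Q' \<Longrightarrow> eval_mpoly l x = 0"
proof -
  obtain q v where q: "q v = 1" "Q = {\<lambda>w. a * q w |a. a \<noteq> (0::'k)}"
    using proj_space_rep[OF assms(1)] .
  obtain p u where p: "p u = 1" "Q' = {\<lambda>w. a * p w |a. a \<noteq> (0::'k)}"
    using proj_space_rep[OF assms(2)] .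
  \<comment> \<open>As \<open>p u = 1\<close>, these are 2 by 2 minors of the coordinates against
    \<open>p\<close>. All vanish at \<open>p\<close>; if all vanished at \<open>q\<close>, then
    \<open>q\<close> would be \<open>q u\<close> times \<open>p\<close>.\<close>
  define l where "l w = Var w - smult_mpoly (p w) (Var u)" for w
  have l: "l w \<in> forms 1" for w
    unfolding l_def by (intro forms_diff forms_smult Var_forms)
  have el: "eval_mpoly (l w) x = x w - p w * x u" for w x
    by (simp add: l_def eval.psubst_diff)
  have "\<exists>w. q w \<noteq> p w * q u"
  proof (rule ccontr)
    assume "\<not> ?thesis"
    then have qp: "q w = q u * p w" for w by (metis mult.commute)
    have "q u \<noteq> 0" using q(1) qp[of v] by (metis mult_zero_left zero_neq_one)
    have "Q = Q'"
    proof (intro set_eqI iffI)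
      fix x assume "x \<in> Q"
      then obtain a where "a \<noteq> 0" "x = (\<lambda>w. a * q w)" using q(2) by auto
      then have "x = (\<lambda>w. (a * q u) * p w)" by (simp add: fun_eq_iff mult.assoc flip: qp)
      then show "x \<in> Q'" unfolding p(2) using \<open>a \<noteq> 0\<close> \<open>q u \<noteq> 0\<close> by (intro CollectI exI[of _ "a * q u"]) auto
    next
      fix x assume "x \<in> Q'"
      then obtain a where a: "a \<noteq> 0" "x = (\<lambda>w. a * p w)" using p(2) by auto
      have "x w = (a / q u) * q w" for w
        unfolding a(2) by (subst (2) qp) (simp add: \<open>q u \<noteq> 0\<close>)
      then have "x = (\<lambda>w. (a / q u) * q w)" by (rule ext)
      then show "x \<in> Q" unfolding q(2) using a \<open>q u \<noteq> 0\<close> by (intro CollectI exI[of _ "a / q u"]) auto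
    qed
    with assms(3) show False by contradiction
  qed
  then obtain w where "q w \<noteq> p w * q u" ..
  then have "eval_mpoly (l w) q \<noteq> 0" "eval_mpoly (l w) p = 0"
    using p(1) by (auto simp: el)
  then show thesis
    using form_zero_iff(2)[OF l q(2)] form_zero_iff(1)[OF l p(2)] by (intro that[OF l]) auto
qed

text \<open>A product of separating linear forms, one for each point of \<open>S\<close>, which
  accounts for the degree.\<close>

lemma exists_separating_form:
  fixes S :: "('v::finite \<Rightarrow> 'k::field) set set"
  assumes "finite S" "S \<subseteq> proj_space" "Q \<in> proj_space" "Q \<notin> S"
  shows "\<exists>s. s \<in> forms (card S) \<and> (\<forall>x\<in>Q. eval_mpoly s x \<noteq> 0)
    \<and> (\<forall>Q'\<in>S. \<forall>x\<in>Q'. eval_mpoly s x = 0)"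
proof -
  have "\<exists>l. l \<in> forms 1 \<and> (\<forall>x\<in>Q. eval_mpoly l x \<noteq> 0) \<and> (\<forall>x\<in>Q'. eval_mpoly l x = 0)"
    if "Q' \<in> S" for Q'
  proof -
    have "Q' \<in> proj_space" "Q \<noteq> Q'"
      using assms that by auto
    from exists_separating_linear_form[OF assms(3) this] show ?thesis
      by metis
  qed
  then obtain l where l: "\<And>Q'. Q' \<in> S \<Longrightarrow> l Q' \<in> forms 1
      \<and> (\<forall>x\<in>Q. eval_mpoly (l Q') x \<noteq> 0) \<and> (\<forall>x\<in>Q'. eval_mpoly (l Q') x = 0)"
    by metis
  have "(\<Prod>Q'\<in>S. l Q') \<in> forms (\<Sum>Q'\<in>S. 1)"
    using l by (intro forms_prod) blast
  then show ?thesis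
    using l assms(1) by (intro exI[of _ "\<Prod>Q'\<in>S. l Q'"]) (auto simp: eval.psubst_prod)
qed

section \<open>Powers of the ideal of a coordinate point\<close>

text \<open>The degree in the variables that vanish at the coordinate point of \<open>v\<close>,
  that is, the order of a monomial in the affine coordinates around that point.\<close>

definition off_degree :: "'v \<Rightarrow> ('v::finite \<Rightarrow>\<^sub>0 nat) \<Rightarrow> nat" where
  "off_degree v t = (\<Sum>w\<in>UNIV - {v}. Poly_Mapping.lookup t w)"

lemma mdeg_eq_off_degree: "mdeg t = Poly_Mapping.lookup t v + off_degree v t"
  unfolding mdeg_def off_degree_def by (subst sum.remove[of _ v]) auto

lemma off_degree_add: "off_degree v (s + t) = off_degree v s + off_degree v t"
  by (simp add: off_degree_def lookup_add sum.distrib)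

lemma off_degree_single_same [simp]: "off_degree v (Poly_Mapping.single v k) = 0"
  by (simp add: off_degree_def lookup_single)

lemma off_degree_eq_0_iff: "off_degree v t = 0 \<longleftrightarrow> t = Poly_Mapping.single v (mdeg t)"
proof
  assume 0: "off_degree v t = 0"
  then have "Poly_Mapping.lookup t w = 0" if "w \<noteq> v" for w
    using that by (simp add: off_degree_def)
  moreover have "Poly_Mapping.lookup t v = mdeg t"
    using 0 mdeg_eq_off_degree[of t v] by simp
  ultimately show "t = Poly_Mapping.single v (mdeg t)"
    by (intro poly_mapping_eqI) (auto simp: lookup_single when_def)
next
  assume "t = Poly_Mapping.single v (mdeg t)"
  then show "off_degree v t = 0"
    by (metis off_degree_single_same)
qed

text \<open>The \<open>m\<close>-th power of the ideal of the coordinate point of \<open>v\<close>: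
  a monomial ideal, so membership is read off the exponents.\<close>

definition axis_pow :: "'v \<Rightarrow> nat \<Rightarrow> ('v::finite, 'k::field) mpoly set" where
  "axis_pow v m = {f. \<forall>t. Poly_Mapping.lookup f t \<noteq> 0 \<longrightarrow> m \<le> off_degree v t}"

lemma axis_pow_add: "f \<in> axis_pow v m \<Longrightarrow> g \<in> axis_pow v m \<Longrightarrow> f + g \<in> axis_pow v m"
  by (auto simp: axis_pow_def lookup_add) (metis add_0)

lemma axis_pow_uminus: "f \<in> axis_pow v m \<Longrightarrow> - f \<in> axis_pow v m"
  by (auto simp: axis_pow_def)

lemma axis_pow_diff: "f \<in> axis_pow v m \<Longrightarrow> g \<in> axis_pow v m \<Longrightarrow> f - g \<in> axis_pow v m"
  using axis_pow_add[of f v m "- g"] axis_pow_uminus[of g v m] by simp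

lemma axis_pow_mono: "k \<le> m \<Longrightarrow> axis_pow v m \<subseteq> axis_pow v k"
  by (auto simp: axis_pow_def)

lemma axis_pow_mult:
  fixes f g :: "('v::finite, 'k::field) mpoly"
  assumes "f \<in> axis_pow v k" and "g \<in> axis_pow v m"
  shows "f * g \<in> axis_pow v (k + m)"
  unfolding axis_pow_def
proof (intro CollectI allI impI)
  fix t assume "Poly_Mapping.lookup (f * g) t \<noteq> 0"
  then obtain a b where "a \<in> Poly_Mapping.keys f" "b \<in> Poly_Mapping.keys g" "t = a + b"
    using keys_mult[of f g] by (auto simp: in_keys_iff)
  then show "k + m \<le> off_degree v t"
    using assms by (auto simp: off_degree_add axis_pow_def in_keys_iff intro: add_mono)
qed

lemma subspace_axis_pow: "ideal.subspace (axis_pow v m)"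
  unfolding ideal.subspace_def
proof (intro conjI ballI allI)
  fix c x :: "('a, 'b) mpoly" assume "x \<in> axis_pow v m"
  moreover have "c \<in> axis_pow v 0" by (simp add: axis_pow_def)
  ultimately show "c * x \<in> axis_pow v m"
    using axis_pow_mult[of c v 0 x m] by simp
qed (simp_all add: axis_pow_add, simp add: axis_pow_def)

lemma lookup_single_mult:
  fixes f :: "('v::finite, 'k::field) mpoly"
  shows "Poly_Mapping.lookup (Poly_Mapping.single u c * f) (u + t) = c * Poly_Mapping.lookup f t"
proof -
  have "Poly_Mapping.single u c * f
      = (\<Sum>s\<in>Poly_Mapping.keys f. Poly_Mapping.single (u + s) (c * Poly_Mapping.lookup f s))"
    by (subst mpoly_eq_sum_single[of f]) (simp only: sum_distrib_left mult_single)
  then show ?thesis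
    by (simp add: lookup_sum lookup_single when_def in_keys_iff)
qed

text \<open>Locally at the coordinate point \<open>s\<close> is a unit: it is \<open>c\<close> times
  a power of \<open>Var v\<close>, plus some \<open>p\<close> of off-degree at least 1. If
  \<open>f\<close> has off-degree at least \<open>k < m\<close>, then so much as
  \<open>Suc k\<close> holds for \<open>s * f - p * f\<close>, which is
  \<open>Poly_Mapping.single u c * f\<close>; and a power of \<open>Var v\<close> does not change
  off-degrees.\<close>

lemma axis_pow_cancel:
  fixes s f :: "('v::finite, 'k::field) mpoly"
  assumes s: "s \<in> forms j" "Poly_Mapping.lookup s (Poly_Mapping.single v j) \<noteq> 0"
    and sf: "s * f \<in> axis_pow v m"
  shows "f \<in> axis_pow v m"
proof -
  define u where "u = Poly_Mapping.single v j"
  define c where "c = Poly_Mapping.lookup s u"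
  define p where "p = s - Poly_Mapping.single u c"
  have c: "c \<noteq> 0" using s(2) by (simp add: c_def u_def)
  have p: "p \<in> axis_pow v 1"
    unfolding axis_pow_def
  proof (intro CollectI allI impI)
    fix t assume t: "Poly_Mapping.lookup p t \<noteq> 0"
    then have tu: "t \<noteq> u" by (auto simp: p_def c_def lookup_minus)
    then have "Poly_Mapping.lookup s t \<noteq> 0"
      using t by (simp add: p_def lookup_minus lookup_single when_def)
    then have "mdeg t = j" using s(1) by (simp add: forms_iff_mdeg)
    then show "1 \<le> off_degree v t"
      using tu off_degree_eq_0_iff[of v t] by (cases "off_degree v t") (auto simp: u_def)
  qed
  have "f \<in> axis_pow v k" if "k \<le> m" for k
    using that
  proof (induction k)
    case 0
    show ?case by (simp add: axis_pow_def)
  next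
    case (Suc k)
    have "Poly_Mapping.single u c * f = s * f - p * f"
      by (simp add: p_def algebra_simps)
    also have "\<dots> \<in> axis_pow v (Suc k)"
      using axis_pow_mult[OF p, of f k] Suc sf axis_pow_mono[OF Suc.prems, of v]
      by (intro axis_pow_diff) auto
    finally have *: "Poly_Mapping.single u c * f \<in> axis_pow v (Suc k)" .
    show ?case
      unfolding axis_pow_def
    proof (intro CollectI allI impI)
      fix t assume "Poly_Mapping.lookup f t \<noteq> 0"
      then have "Poly_Mapping.lookup (Poly_Mapping.single u c * f) (u + t) \<noteq> 0"
        using c by (simp add: lookup_single_mult)
      then have "Suc k \<le> off_degree v (u + t)"
        using * by (simp add: axis_pow_def)
      then show "Suc k \<le> off_degree v t"
        by (simp add: off_degree_add u_def)
    qed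
  qed
  then show ?thesis by blast
qed

text \<open>Any other monomial of degree \<open>i\<close> contains a variable that is 0 at this
  vector.\<close>

lemma eval_unit:
  assumes "f \<in> forms i"
  shows "eval_mpoly f (\<lambda>w. if w = v then 1 else 0) = Poly_Mapping.lookup f (Poly_Mapping.single v i)"
proof -
  have *: "(\<Prod>w\<in>UNIV. (if w = v then 1 else 0 :: 'b) ^ Poly_Mapping.lookup t w)
      = (if t = Poly_Mapping.single v i then 1 else 0)" if "mdeg t = i" for t
  proof (cases "off_degree v t = 0")
    case True
    then have "t = Poly_Mapping.single v i"
      using off_degree_eq_0_iff that by blast
    then show ?thesis
      by (auto intro!: prod.neutral simp: lookup_single when_def)
  next
    case False
    then obtain w where "w \<noteq> v" "Poly_Mapping.lookup t w \<noteq> 0"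
      by (auto simp: off_degree_def)
    then have "(\<Prod>w\<in>UNIV. (if w = v then 1 else 0 :: 'b) ^ Poly_Mapping.lookup t w) = 0"
      by (auto intro!: bexI[of _ w])
    moreover have "t \<noteq> Poly_Mapping.single v i"
      using False by auto
    ultimately show ?thesis by simp
  qed
  have "eval_mpoly f (\<lambda>w. if w = v then 1 else 0)
    = (\<Sum>t\<in>Poly_Mapping.keys f. if t = Poly_Mapping.single v i then Poly_Mapping.lookup f t else 0)"
    unfolding eval_mpoly_def
    by (intro sum.cong) (use assms in \<open>simp_all add: * forms_iff_mdeg in_keys_iff\<close>)
  also have "\<dots> = Poly_Mapping.lookup f (Poly_Mapping.single v i)"
    by (simp add: in_keys_iff)
  finally show ?thesis .
qed

section \<open>Powers of the ideal of a point\<close>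

text \<open>A linear change of coordinates that takes the coordinate point of \<open>v\<close> to
  \<open>q\<close> when \<open>q v = 1\<close>. The separate case \<open>w = v\<close> fixes
  \<open>Var v\<close> whatever \<open>q v\<close> is, so that negating \<open>q\<close> always
  gives the inverse.\<close>

definition translation :: "'v \<Rightarrow> ('v \<Rightarrow> 'k) \<Rightarrow> 'v \<Rightarrow> ('v::finite, 'k::field) mpoly" where
  "translation v q w = (if w = v then Var v else Var w + smult_mpoly (q w) (Var v))"

lemma translation_forms: "translation v q w \<in> forms 1"
  unfolding translation_def using Var_forms by (auto intro!: forms_add forms_smult simp del: One_nat_def)

lemma translation_inverse:
  "csubst (translation v (\<lambda>w. - q w)) (csubst (translation v q) f) = f"
  "csubst (translation v q) (csubst (translation v (\<lambda>w. - q w)) f) = f"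
proof -
  have "(\<lambda>w. csubst (translation v (\<lambda>w. - p w)) (translation v p w)) = Var" for p :: "'a \<Rightarrow> 'b"
    by (auto simp: translation_def csubst.psubst_add csubst_smult fun_eq_iff simp flip: mpoly_vs.scale_left_distrib)
  from this[of q] this[of "\<lambda>w. - q w"]
  show "csubst (translation v (\<lambda>w. - q w)) (csubst (translation v q) f) = f"
    "csubst (translation v q) (csubst (translation v (\<lambda>w. - q w)) f) = f"
    by (simp_all add: csubst_csubst csubst_id)
qed

lemma eval_translation:
  assumes "q v = 1"
  shows "eval_mpoly (csubst (translation v q) f) (\<lambda>w. if w = v then 1 else 0) = eval_mpoly f q"
proof -
  have "(\<lambda>w. eval_mpoly (translation v q w) (\<lambda>w. if w = v then 1 else 0)) = q"
    using assms by (auto simp: translation_def eval.psubst_add fun_eq_iff)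
  then show ?thesis by (simp add: eval_csubst)
qed

lemma ideal_pow_mult:
  assumes "a \<in> I" "b \<in> ideal_pow I m"
  shows "a * b \<in> ideal_pow I (Suc m)"
  using assms by (auto intro: ideal.span_base)

lemma subspace_ideal_pow: "ideal.subspace (ideal_pow I m)"
  by (cases m) auto

lemma ideal_pow_power_mult:
  assumes "a \<in> I" "b \<in> ideal_pow I m"
  shows "a ^ k * b \<in> ideal_pow I (k + m)"
proof (induction k)
  case (Suc k)
  show ?case
    using ideal_pow_mult[OF assms(1) Suc.IH] by (simp only: power_Suc mult.assoc add_Suc)
qed (simp add: assms)

lemma ideal_pow_prod:
  assumes "finite A" "\<And>x. x \<in> A \<Longrightarrow> f x \<in> I"
  shows "(\<Prod>x\<in>A. f x ^ e x) \<in> ideal_pow I (\<Sum>x\<in>A. e x)"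
  using assms
proof (induction A rule: finite_induct)
  case (insert x A)
  then show ?case
    using ideal_pow_power_mult[of "f x" I "\<Prod>x\<in>A. f x ^ e x" "\<Sum>x\<in>A. e x" "e x"] by simp
qed simp

lemma ideal_pow_antimono: "k \<le> m \<Longrightarrow> ideal_pow I m \<subseteq> ideal_pow I k"
proof (induction m rule: dec_induct)
  case (step m)
  have "ideal_pow I (Suc m) \<subseteq> ideal_pow I m"
    unfolding ideal_pow.simps
    by (rule ideal.span_minimal) (auto intro: ideal.subspace_scale subspace_ideal_pow)
  with step show ?case by blast
qed simp

locale normalized_point =
  fixes Q :: "('v::finite \<Rightarrow> 'k::field) set" and q :: "'v \<Rightarrow> 'k" and v :: 'v
  assumes qv: "q v = 1" and Q: "Q = {\<lambda>w. a * q w |a. a \<noteq> 0}"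
begin

text \<open>The translate of a form of degree \<open>i\<close> is a form whose coefficient at the
  \<open>i\<close>-th power of \<open>Var v\<close> is the value at \<open>q\<close>; when this is
  0, every remaining monomial involves another variable.\<close>

lemma translation_vanishing_ideal:
  assumes "f \<in> vanishing_ideal {Q}"
  shows "csubst (translation v q) f \<in> axis_pow v 1"
  using assms unfolding vanishing_ideal_def
proof (induction rule: ideal.span_induct_alt)
  case (step c f g)
  then obtain i where i: "f \<in> forms i" and "\<forall>x\<in>Q. eval_mpoly f x = 0" by auto
  then have f: "eval_mpoly f q = 0"
    using form_zero_iff(1)[OF i Q] by blast
  have *: "csubst (translation v q) f \<in> forms i"
    by (rule csubst_forms[OF translation_forms i])
  have "csubst (translation v q) f \<in> axis_pow v 1"
    unfolding axis_pow_def
  proof (intro CollectI allI impI)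
    fix t assume t: "Poly_Mapping.lookup (csubst (translation v q) f) t \<noteq> 0"
    then have "mdeg t = i" using * by (simp add: forms_iff_mdeg)
    then show "1 \<le> off_degree v t"
      using eval_unit[OF *, of v] eval_translation[of q v f, OF qv] f t off_degree_eq_0_iff[of v t]
      by (cases "off_degree v t") auto
  qed
  then show ?case
    using step by (simp add: csubst.psubst_add csubst.psubst_mult axis_pow_add
        ideal.subspace_scale[OF subspace_axis_pow])
qed (simp add: axis_pow_def)

lemma translation_ideal_pow:
  assumes "f \<in> ideal_pow (vanishing_ideal {Q}) m"
  shows "csubst (translation v q) f \<in> axis_pow v m"
  using assms
proof (induction m arbitrary: f)
  case 0
  show ?case by (simp add: axis_pow_def)
next
  case (Suc m)
  from Suc.prems show ?case
    unfolding ideal_pow.simps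
  proof (induction rule: ideal.span_induct_alt)
    case (step c f g)
    then obtain a b where "f = a * b" "a \<in> vanishing_ideal {Q}" "b \<in> ideal_pow (vanishing_ideal {Q}) m"
      by blast
    then have "csubst (translation v q) f \<in> axis_pow v (Suc m)"
      using axis_pow_mult[OF translation_vanishing_ideal Suc.IH, of a b] by (simp add: csubst.psubst_mult)
    then show ?case
      using step by (simp add: csubst.psubst_add csubst.psubst_mult axis_pow_add
        ideal.subspace_scale[OF subspace_axis_pow])
  qed (simp add: axis_pow_def)
qed

lemma translation_Var_vanishing:
  assumes "w \<noteq> v"
  shows "translation v (\<lambda>w. - q w) w \<in> vanishing_ideal {Q}"
proof -
  have "eval_mpoly (translation v (\<lambda>w. - q w) w) q = 0"
    using qv assms by (simp add: translation_def eval.psubst_add eval.psubst_diff)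
  then show ?thesis
    unfolding vanishing_ideal_def
    using form_zero_iff(1)[OF translation_forms Q, of v "\<lambda>w. - q w" w] translation_forms[of v _ w]
    by (intro ideal.span_base) blast
qed

text \<open>A monomial of off-degree at least \<open>m\<close> is sent to a power of
  \<open>Var v\<close> times at least \<open>m\<close> linear forms
  \<open>translation v (\<lambda>w. - q w) w\<close> with \<open>w \<noteq> v\<close>, each of which
  vanishes at \<open>q\<close> because \<open>q v = 1\<close>.\<close>

lemma translation_axis_pow:
  assumes "f \<in> axis_pow v m"
  shows "csubst (translation v (\<lambda>w. - q w)) f \<in> ideal_pow (vanishing_ideal {Q}) m"
  unfolding csubst.psubst_def
proof (rule ideal.subspace_sum[OF subspace_ideal_pow])
  let ?g = "translation v (\<lambda>w. - q w)"
  fix t assume "t \<in> Poly_Mapping.keys f"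
  then have t: "m \<le> off_degree v t"
    using assms by (simp add: axis_pow_def in_keys_iff)
  have "(\<Prod>w\<in>UNIV - {v}. ?g w ^ Poly_Mapping.lookup t w) \<in> ideal_pow (vanishing_ideal {Q}) (off_degree v t)"
    unfolding off_degree_def by (rule ideal_pow_prod) (auto intro: translation_Var_vanishing)
  then have "(\<Prod>w\<in>UNIV - {v}. ?g w ^ Poly_Mapping.lookup t w) \<in> ideal_pow (vanishing_ideal {Q}) m"
    using ideal_pow_antimono[OF t] by blast
  then have *: "(\<Prod>w\<in>UNIV. ?g w ^ Poly_Mapping.lookup t w) \<in> ideal_pow (vanishing_ideal {Q}) m"
    by (subst prod.remove[of _ v]) (auto intro: ideal.subspace_scale[OF subspace_ideal_pow])
  show "Poly_Mapping.single 0 (Poly_Mapping.lookup f t) * (\<Prod>w\<in>UNIV. ?g w ^ Poly_Mapping.lookup t w)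
    \<in> ideal_pow (vanishing_ideal {Q}) m"
    by (rule ideal.subspace_scale[OF subspace_ideal_pow *])
qed

text \<open>Turns the ideal of a fat point into a monomial ideal, where cancellation and dimension
  counts are done on exponents.\<close>

lemma ideal_pow_iff:
  "f \<in> ideal_pow (vanishing_ideal {Q}) m \<longleftrightarrow> csubst (translation v q) f \<in> axis_pow v m"
  using translation_ideal_pow translation_axis_pow translation_inverse(1)[of v q f] by metis

lemma ideal_pow_cancel:
  assumes s: "s \<in> forms j" "eval_mpoly s q \<noteq> 0"
    and sf: "s * f \<in> ideal_pow (vanishing_ideal {Q}) m"
  shows "f \<in> ideal_pow (vanishing_ideal {Q}) m"
proof -
  have *: "csubst (translation v q) s \<in> forms j"
    by (rule csubst_forms[OF translation_forms s(1)])
  have "Poly_Mapping.lookup (csubst (translation v q) s) (Poly_Mapping.single v j) \<noteq> 0"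
    using eval_unit[OF *, of v] eval_translation[of q v s, OF qv] s(2) by simp
  from axis_pow_cancel[OF * this] show ?thesis
    using sf by (simp add: ideal_pow_iff csubst.psubst_mult)
qed

end

lemma point_ideal_pow_cancel:
  fixes Q :: "('v::finite \<Rightarrow> 'k::field) set"
  assumes "Q \<in> proj_space" and "s \<in> forms j" "\<forall>x\<in>Q. eval_mpoly s x \<noteq> 0"
    and "s * f \<in> ideal_pow (vanishing_ideal {Q}) m"
  shows "f \<in> ideal_pow (vanishing_ideal {Q}) m"
proof -
  obtain q v where q: "q v = 1" "Q = {\<lambda>w. a * q w |a. a \<noteq> (0::'k)}"
    using proj_space_rep[OF assms(1)] .
  then interpret normalized_point Q q v by unfold_locales
  show ?thesis
    using ideal_pow_cancel assms form_zero_iff(2)[OF assms(2) Q] by blast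
qed

section \<open>Hilbert functions\<close>

lemma hilbert_fun_basis:
  assumes "ideal.subspace I" and "basis_modulo I (forms i) B"
  shows "hilbert_fun I i = card B"
proof -
  obtain S where "finite S" "(forms i :: ('a, 'b) mpoly set) \<subseteq> mpoly_vs.span S"
    using forms_finite_span by blast
  from basis_modulo_exists_card(2)[OF ideal_imp_subspace[OF assms(1)] forms_subspace this assms(2)]
  show ?thesis
    by (simp add: hilbert_fun_eq_diff[OF assms(1)])
qed

lemma hilbert_basis_exists:
  fixes I :: "('v::finite, 'k::field) mpoly set"
  assumes "ideal.subspace I"
  obtains B where "basis_modulo I (forms i) B" and "card B = hilbert_fun I i"
proof -
  obtain S where "finite S" "(forms i :: ('v, 'k) mpoly set) \<subseteq> mpoly_vs.span S"
    using forms_finite_span by blast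
  from basis_modulo_exists_card(1)[OF ideal_imp_subspace[OF assms(1)] forms_subspace this]
  show thesis
    using that hilbert_fun_basis[OF assms] by metis
qed

text \<open>The basis is a family indexed by \<open>T\<close>, so that bases can be joined over
  disjoint sums of index sets. Independence makes the family injective: coefficients 1 and -1 at two
  indices with equal values would give a nontrivial relation.\<close>

lemma hilbert_fun_eqI:
  fixes I :: "('v::finite, 'k::field) mpoly set"
  assumes I: "ideal.subspace I" and T: "finite T" and g: "\<And>t. t \<in> T \<Longrightarrow> g t \<in> forms i"
    and ind: "\<And>c t. (\<Sum>t\<in>T. smult_mpoly (c t) (g t)) \<in> I \<Longrightarrow> t \<in> T \<Longrightarrow> c t = 0"
    and span: "\<And>f. f \<in> forms i \<Longrightarrow> \<exists>c. f - (\<Sum>t\<in>T. smult_mpoly (c t) (g t)) \<in> I"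
  shows "hilbert_fun I i = card T"
proof -
  have inj: "inj_on g T"
  proof (rule inj_onI, rule ccontr)
    fix t u assume tu: "t \<in> T" "u \<in> T" "g t = g u" "t \<noteq> u"
    let ?c = "\<lambda>x. if x = t then 1 else if x = u then - 1 else 0 :: 'k"
    have "(\<Sum>x\<in>T. smult_mpoly (?c x) (g x)) = (\<Sum>x\<in>{t, u}. smult_mpoly (?c x) (g x))"
      using T tu by (intro sum.mono_neutral_right) auto
    also have "\<dots> = 0"
      using tu by (simp add: mpoly_vs.scale_minus_left)
    finally have "?c t = 0"
      using ind[of ?c t] tu(1) ideal.subspace_0[OF I] by metis
    then show False by simp
  qed
  have "basis_modulo I (forms i) (g ` T)"
    unfolding basis_modulo_def
  proof (intro conjI allI impI ballI)
    fix c b assume "(\<Sum>b\<in>g ` T. smult_mpoly (c b) b) \<in> I" "b \<in> g ` T"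
    then show "c b = 0"
      using ind[of "\<lambda>t. c (g t)"] by (auto simp: sum.reindex[OF inj])
  next
    fix f :: "('v, 'k) mpoly" assume "f \<in> forms i"
    then obtain c where c: "f - (\<Sum>t\<in>T. smult_mpoly (c t) (g t)) \<in> I"
      using span by blast
    have "(\<Sum>b\<in>g ` T. smult_mpoly (c (the_inv_into T g b)) b) = (\<Sum>t\<in>T. smult_mpoly (c t) (g t))"
      by (simp add: sum.reindex[OF inj] the_inv_into_f_f[OF inj])
    with c show "\<exists>c. f - (\<Sum>b\<in>g ` T. smult_mpoly (c b) b) \<in> I"
      by (intro exI[of _ "\<lambda>b. c (the_inv_into T g b)"]) simp
  qed (use T g in auto)
  from hilbert_fun_basis[OF I this] show ?thesis
    by (simp add: card_image[OF inj])
qed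

lemma hilbert_fun_eq_0_iff:
  fixes I :: "('v::finite, 'k::field) mpoly set"
  assumes "ideal.subspace I"
  shows "hilbert_fun I i = 0 \<longleftrightarrow> forms i \<subseteq> I"
proof
  assume 0: "hilbert_fun I i = 0"
  obtain B where B: "basis_modulo I (forms i) B" "card B = hilbert_fun I i"
    using hilbert_basis_exists[OF assms] .
  then have "B = {}"
    using 0 by (simp add: basis_modulo_def)
  then show "forms i \<subseteq> I"
    using B(1) by (auto simp: basis_modulo_def)
next
  assume "forms i \<subseteq> I"
  then show "hilbert_fun I i = 0"
    using hilbert_fun_eqI[OF assms, of "{} :: nat set"] by auto
qed

section \<open>Additivity of Hilbert functions\<close>

lemma smult_mult_left: "smult_mpoly a (f * g) = smult_mpoly a f * g"
  unfolding smult_mpoly_def by (rule mult.assoc[symmetric])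

lemma smult_in_ideal: "ideal.subspace I \<Longrightarrow> f \<in> I \<Longrightarrow> smult_mpoly a f \<in> I"
  unfolding smult_mpoly_def by (rule ideal.subspace_scale)

lemma mem_span_insert:
  "ideal.subspace I \<Longrightarrow> x \<in> ideal.span (insert f I) \<longleftrightarrow> (\<exists>k. x - k * f \<in> I)"
  by (simp add: ideal.span_breakdown_eq ideal.span_eq_iff[THEN iffD2])

text \<open>Taking the component of degree \<open>i + d\<close> replaces an arbitrary multiplier by
  its component of degree \<open>i\<close>.\<close>

lemma form_mem_span_insert:
  assumes I: "homogeneous_ideal I" and f: "f \<in> forms d" and x: "x \<in> forms (i + d)"
    and "x \<in> ideal.span (insert f I)"
  obtains k where "k \<in> forms i" and "x - k * f \<in> I"
proof -
  obtain k where "x - k * f \<in> I"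
    using assms mem_span_insert homogeneous_ideal_subspace by blast
  then have "hcomp (i + d) (x - k * f) \<in> I"
    using I by (simp add: homogeneous_ideal_def)
  then have "x - hcomp i k * f \<in> I"
    by (simp add: hcomp_diff hcomp_form[OF x] hcomp_mult_form(1)[OF f])
  then show thesis
    using that hcomp_forms by blast
qed

text \<open>Multiplication by \<open>f\<close> embeds the quotient by \<open>I\<close> in degree
  \<open>i\<close> into that in degree \<open>i + d\<close>, with cokernel the quotient by
  \<open>I + (f)\<close>. Accordingly a basis \<open>B\<close> of the cokernel and the products of
  \<open>f\<close> with a basis \<open>C\<close> of the source form a basis in the middle.\<close>

lemma hilbert_fun_span_insert:
  fixes I :: "('v::finite, 'k::field) mpoly set"
  assumes I: "homogeneous_ideal I" and f: "f \<in> forms d"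
    and cancel: "\<And>g. f * g \<in> I \<Longrightarrow> g \<in> I"
  shows "hilbert_fun (ideal.span (insert f I)) (i + d) + hilbert_fun I i = hilbert_fun I (i + d)"
proof -
  let ?J = "ideal.span (insert f I)"
  have sI: "ideal.subspace I" and sJ: "ideal.subspace ?J"
    using I homogeneous_ideal_subspace by auto
  have IJ: "I \<subseteq> ?J" by (auto intro: ideal.span_base)
  obtain B where B: "basis_modulo ?J (forms (i + d)) B" "card B = hilbert_fun ?J (i + d)"
    using hilbert_basis_exists[OF sJ] .
  obtain C where C: "basis_modulo I (forms i) C" "card C = hilbert_fun I i"
    using hilbert_basis_exists[OF sI] .
  have fin: "finite B" "finite C" and BC: "B \<subseteq> forms (i + d)" "C \<subseteq> forms i"
    using B C by (auto simp: basis_modulo_def)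
  let ?g = "case_sum (\<lambda>b. b) (\<lambda>x. x * f)"
  have sum: "(\<Sum>t\<in>B <+> C. smult_mpoly (c t) (?g t))
      = (\<Sum>b\<in>B. smult_mpoly (c (Inl b)) b) + (\<Sum>x\<in>C. smult_mpoly (c (Inr x)) x) * f" for c
    using fin by (simp add: sum.Plus smult_mult_left sum_distrib_right)
  have fJ: "k * f \<in> ?J" for k
    by (intro ideal.span_scale ideal.span_base) simp
  have "hilbert_fun I (i + d) = card (B <+> C)"
  proof (rule hilbert_fun_eqI[OF sI, where g = ?g])
    fix t assume "t \<in> B <+> C"
    then show "?g t \<in> forms (i + d)"
      using BC forms_mult[OF _ f] by auto
  next
    fix c t assume sumI: "(\<Sum>t\<in>B <+> C. smult_mpoly (c t) (?g t)) \<in> I" and t: "t \<in> B <+> C"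
    let ?b = "\<Sum>b\<in>B. smult_mpoly (c (Inl b)) b" and ?x = "\<Sum>x\<in>C. smult_mpoly (c (Inr x)) x"
    have "?b + ?x * f \<in> ?J"
      using sumI IJ unfolding sum by blast
    then have "?b \<in> ?J"
      using fJ ideal.span_add_eq2 by blast
    then have b0: "c (Inl b) = 0" if "b \<in> B" for b
      using B(1) that by (auto simp: basis_modulo_def)
    then have "?x * f \<in> I"
      using sumI unfolding sum by simp
    then have "?x \<in> I"
      by (subst (asm) mult.commute) (rule cancel)
    then have "c (Inr x) = 0" if "x \<in> C" for x
      using C(1) that by (auto simp: basis_modulo_def)
    with b0 t show "c t = 0" by auto
  next
    fix h :: "('v, 'k) mpoly" assume h: "h \<in> forms (i + d)"
    then obtain c where c: "h - (\<Sum>b\<in>B. smult_mpoly (c b) b) \<in> ?J"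
      using B(1) by (auto simp: basis_modulo_def)
    have "h - (\<Sum>b\<in>B. smult_mpoly (c b) b) \<in> forms (i + d)"
      using h BC by (intro forms_diff forms_sum forms_smult) auto
    from form_mem_span_insert[OF I f this c] obtain k
      where k: "k \<in> forms i" "h - (\<Sum>b\<in>B. smult_mpoly (c b) b) - k * f \<in> I" .
    obtain e where e: "k - (\<Sum>x\<in>C. smult_mpoly (e x) x) \<in> I"
      using C(1) k(1) by (auto simp: basis_modulo_def)
    have "h - (\<Sum>b\<in>B. smult_mpoly (c b) b) - k * f + f * (k - (\<Sum>x\<in>C. smult_mpoly (e x) x)) \<in> I"
      by (intro ideal.subspace_add[OF sI] k ideal.subspace_scale[OF sI] e)
    also have "h - (\<Sum>b\<in>B. smult_mpoly (c b) b) - k * f + f * (k - (\<Sum>x\<in>C. smult_mpoly (e x) x))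
      = h - (\<Sum>t\<in>B <+> C. smult_mpoly (case_sum c e t) (?g t))"
      unfolding sum by (simp add: algebra_simps)
    finally show "\<exists>c. h - (\<Sum>t\<in>B <+> C. smult_mpoly (c t) (?g t)) \<in> I"
      by (rule exI[of _ "case_sum c e"])
  qed (use fin in simp)
  then show ?thesis
    using B(2) C(2) fin by (simp add: card_Plus)
qed

text \<open>The degree \<open>j\<close> part of any multiple of \<open>f\<close> is 0, so the ideal
  gains nothing in degree \<open>j\<close>.\<close>

lemma hilbert_fun_span_insert_less:
  assumes I: "homogeneous_ideal I" and f: "f \<in> forms d" and j: "j < d"
  shows "hilbert_fun (ideal.span (insert f I)) j = hilbert_fun I j"
proof -
  have sI: "ideal.subspace I"
    using I homogeneous_ideal_subspace by auto
  have "x \<in> I" if x: "x \<in> forms j" "x \<in> ideal.span (insert f I)" for x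
  proof -
    obtain k where "x - k * f \<in> I"
      using x mem_span_insert[OF sI] by blast
    then have "hcomp j (x - k * f) \<in> I"
      using I by (simp add: homogeneous_ideal_def)
    then show ?thesis
      by (simp add: hcomp_diff hcomp_form[OF x(1)] hcomp_mult_form(2)[OF f j])
  qed
  then have "forms j \<inter> ideal.span (insert f I) = forms j \<inter> I"
    by (auto intro: ideal.span_base)
  then show ?thesis
    by (simp add: hilbert_fun_eq_diff sI)
qed

text \<open>Chinese remainder theorem in degree \<open>i\<close>. Each \<open>x\<close> in
  \<open>C\<close> is replaced by a form \<open>a x\<close> in \<open>I\<close> congruent to it
  modulo \<open>J\<close>. The combined family is triangular: modulo \<open>I\<close> only
  \<open>B\<close> remains, and once its coefficients are 0, modulo \<open>J\<close> the
  \<open>a x\<close> act as the basis \<open>C\<close>.\<close>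

lemma hilbert_fun_Int:
  fixes I J :: "('v::finite, 'k::field) mpoly set"
  assumes I: "homogeneous_ideal I" and J: "homogeneous_ideal J"
    and sum: "\<And>f. f \<in> forms i \<Longrightarrow> \<exists>a\<in>I. f - a \<in> J"
  shows "hilbert_fun (I \<inter> J) i = hilbert_fun I i + hilbert_fun J i"
proof -
  have sI: "ideal.subspace I" and sJ: "ideal.subspace J"
    using I J homogeneous_ideal_subspace by auto
  obtain B where B: "basis_modulo I (forms i) B" "card B = hilbert_fun I i"
    using hilbert_basis_exists[OF sI] .
  obtain C where C: "basis_modulo J (forms i) C" "card C = hilbert_fun J i"
    using hilbert_basis_exists[OF sJ] .
  have fin: "finite B" "finite C" and BC: "B \<subseteq> forms i" "C \<subseteq> forms i"
    using B C by (auto simp: basis_modulo_def)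
  have "\<exists>a. a \<in> I \<and> a \<in> forms i \<and> x - a \<in> J" if x: "x \<in> forms i" for x
  proof -
    obtain a where a: "a \<in> I" "x - a \<in> J"
      using sum[OF x] by blast
    have "hcomp i a \<in> I" "hcomp i (x - a) \<in> J"
      using a I J by (auto simp: homogeneous_ideal_def)
    then show ?thesis
      by (intro exI[of _ "hcomp i a"]) (simp add: hcomp_diff hcomp_form[OF x] hcomp_forms)
  qed
  then obtain a where a: "\<And>x. x \<in> forms i \<Longrightarrow> a x \<in> I \<and> a x \<in> forms i \<and> x - a x \<in> J"
    by metis
  let ?g = "case_sum (\<lambda>b. b) a"
  have sum: "(\<Sum>t\<in>B <+> C. smult_mpoly (c t) (?g t))
      = (\<Sum>b\<in>B. smult_mpoly (c (Inl b)) b) + (\<Sum>x\<in>C. smult_mpoly (c (Inr x)) (a x))" for c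
    using fin by (simp add: sum.Plus)
  have aI: "(\<Sum>x\<in>C. smult_mpoly (c x) (a x)) \<in> I" for c
    using a BC by (intro ideal.subspace_sum[OF sI] smult_in_ideal[OF sI]) auto
  have aJ: "(\<Sum>x\<in>C. smult_mpoly (c x) x) - (\<Sum>x\<in>C. smult_mpoly (c x) (a x)) \<in> J" for c
    unfolding sum_subtractf[symmetric] mpoly_vs.scale_right_diff_distrib[symmetric]
    using a BC by (intro ideal.subspace_sum[OF sJ] smult_in_ideal[OF sJ]) auto
  have "hilbert_fun (I \<inter> J) i = card (B <+> C)"
  proof (rule hilbert_fun_eqI[OF ideal.subspace_inter[OF sI sJ], where g = ?g])
    fix t assume "t \<in> B <+> C"
    then show "?g t \<in> forms i"
      using BC a by auto
  next
    fix c t assume sumI: "(\<Sum>t\<in>B <+> C. smult_mpoly (c t) (?g t)) \<in> I \<inter> J" and t: "t \<in> B <+> C"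
    let ?b = "\<Sum>b\<in>B. smult_mpoly (c (Inl b)) b" and ?a = "\<Sum>x\<in>C. smult_mpoly (c (Inr x)) (a x)"
    have "(?b + ?a) - ?a \<in> I"
      using sumI unfolding sum by (intro ideal.subspace_diff[OF sI] aI) auto
    then have "?b \<in> I" by simp
    then have b0: "c (Inl b) = 0" if "b \<in> B" for b
      using B(1) that by (auto simp: basis_modulo_def)
    then have "?a \<in> J"
      using sumI unfolding sum by simp
    from ideal.subspace_add[OF sJ this aJ[of "\<lambda>x. c (Inr x)"]]
    have "(\<Sum>x\<in>C. smult_mpoly (c (Inr x)) x) \<in> J"
      by simp
    then have "c (Inr x) = 0" if "x \<in> C" for x
      using C(1) that by (auto simp: basis_modulo_def)
    with b0 t show "c t = 0" by auto
  next
    fix h :: "('v, 'k) mpoly" assume h: "h \<in> forms i"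
    then obtain c where c: "h - (\<Sum>b\<in>B. smult_mpoly (c b) b) \<in> I"
      using B(1) by (auto simp: basis_modulo_def)
    have "h - (\<Sum>b\<in>B. smult_mpoly (c b) b) \<in> forms i"
      using h BC by (intro forms_diff forms_sum forms_smult) auto
    \<comment> \<open>The remainder after \<open>B\<close> lies in \<open>I\<close>. Expanding it by
      \<open>C\<close> modulo \<open>J\<close>, but subtracting \<open>a x\<close> in place of
      \<open>x\<close>, brings it into \<open>J\<close> without leaving \<open>I\<close>.\<close>
    then obtain e where e: "h - (\<Sum>b\<in>B. smult_mpoly (c b) b) - (\<Sum>x\<in>C. smult_mpoly (e x) x) \<in> J"
      using C(1) by (auto simp: basis_modulo_def)
    from ideal.subspace_add[OF sJ this aJ[of e]]
    have "h - (\<Sum>b\<in>B. smult_mpoly (c b) b) - (\<Sum>x\<in>C. smult_mpoly (e x) (a x)) \<in> J"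
      by (simp only: diff_add_cancel add_diff_eq)
    moreover have "h - (\<Sum>b\<in>B. smult_mpoly (c b) b) - (\<Sum>x\<in>C. smult_mpoly (e x) (a x)) \<in> I"
      by (intro ideal.subspace_diff[OF sI] c aI)
    ultimately have "h - (\<Sum>b\<in>B. smult_mpoly (c b) b) - (\<Sum>x\<in>C. smult_mpoly (e x) (a x)) \<in> I \<inter> J"
      by (rule IntI[rotated])
    also have "h - (\<Sum>b\<in>B. smult_mpoly (c b) b) - (\<Sum>x\<in>C. smult_mpoly (e x) (a x))
      = h - (\<Sum>t\<in>B <+> C. smult_mpoly (case_sum c e t) (?g t))"
      unfolding sum by (simp add: algebra_simps)
    finally have "h - (\<Sum>t\<in>B <+> C. smult_mpoly (case_sum c e t) (?g t)) \<in> I \<inter> J" .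
    then show "\<exists>c. h - (\<Sum>t\<in>B <+> C. smult_mpoly (c t) (?g t)) \<in> I \<inter> J"
      by (rule exI[of _ "case_sum c e"])
  qed (use fin in simp)
  then show ?thesis
    using B(2) C(2) fin by (simp add: card_Plus)
qed

section \<open>Counting monomials; Hilbert functions of fat points\<close>

lemma card_mdeg:
  "card {t :: 'v::finite \<Rightarrow>\<^sub>0 nat. mdeg t = k} = (k + CARD('v) - 1) choose k"
proof -
  obtain vs :: "'v list" where vs: "set vs = UNIV" "distinct vs"
    using finite_distinct_list[OF finite[of UNIV]] by blast
  have len: "length vs = CARD('v)"
    using distinct_card[OF vs(2)] vs(1) by simp
  \<comment> \<open>Stars and bars: a monomial is the list of its exponents along the enumeration
    \<open>vs\<close>.\<close>
  have "bij_betw (\<lambda>t. map (Poly_Mapping.lookup t) vs) {t. mdeg t = k}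
      {l. length l = CARD('v) \<and> sum_list l = k}"
    unfolding bij_betw_def
  proof (intro conjI inj_onI set_eqI iffI)
    fix s t :: "'v \<Rightarrow>\<^sub>0 nat" assume "map (Poly_Mapping.lookup s) vs = map (Poly_Mapping.lookup t) vs"
    then show "s = t"
      using vs(1) by (intro poly_mapping_eqI) simp
  next
    have "mdeg t = sum_list (map (Poly_Mapping.lookup t) vs)" for t
      unfolding mdeg_def using sum_list_distinct_conv_sum_set[OF vs(2)] vs(1) by metis
    then show "l \<in> {l. length l = CARD('v) \<and> sum_list l = k}"
      if "l \<in> (\<lambda>t. map (Poly_Mapping.lookup t) vs) ` {t. mdeg t = k}" for l
      using that len by auto
  next
    fix l :: "nat list" assume l: "l \<in> {l. length l = CARD('v) \<and> sum_list l = k}"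
    define t where "t = Abs_poly_mapping (\<lambda>v. the (map_of (zip vs l) v))"
    have t: "Poly_Mapping.lookup t = (\<lambda>v. the (map_of (zip vs l) v))"
      unfolding t_def by (rule lookup_Abs_poly_mapping) simp
    have *: "map (Poly_Mapping.lookup t) vs = l"
      using l len vs(2) by (intro nth_equalityI) (auto simp: t map_of_zip_nth)
    moreover have "mdeg t = sum_list (map (Poly_Mapping.lookup t) vs)"
      unfolding mdeg_def using sum_list_distinct_conv_sum_set[OF vs(2)] vs(1) by metis
    ultimately show "l \<in> (\<lambda>t. map (Poly_Mapping.lookup t) vs) ` {t. mdeg t = k}"
      using l by (intro image_eqI[of _ _ t]) auto
  qed
  then have "card {t :: 'v \<Rightarrow>\<^sub>0 nat. mdeg t = k} = card {l. length l = CARD('v) \<and> sum_list l = k}"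
    by (rule bij_betw_same_card)
  then show ?thesis
    by (simp add: card_length_sum_list)
qed

lemma sum_smult_single:
  fixes T :: "('v::finite \<Rightarrow>\<^sub>0 nat) set" and c :: "('v \<Rightarrow>\<^sub>0 nat) \<Rightarrow> 'k::field"
  assumes "finite T"
  shows "Poly_Mapping.lookup (\<Sum>t\<in>T. smult_mpoly (c t) (Poly_Mapping.single t 1)) u
    = (if u \<in> T then c u else 0)"
proof -
  have "Poly_Mapping.lookup (\<Sum>t\<in>T. smult_mpoly (c t) (Poly_Mapping.single t 1)) u
      = (\<Sum>t\<in>T. if t = u then c t else 0)"
    unfolding lookup_sum by (intro sum.cong) (auto simp: lookup_single when_def)
  then show ?thesis
    using assms by simp
qed

lemma hilbert_fun_zero_ideal:
  "hilbert_fun ({0} :: ('v::finite, 'k::field) mpoly set) i = (i + CARD('v) - 1) choose i"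
proof -
  let ?T = "{t :: 'v \<Rightarrow>\<^sub>0 nat. mdeg t = i}"
  have "hilbert_fun ({0} :: ('v, 'k) mpoly set) i = card ?T"
  proof (rule hilbert_fun_eqI[where g = "\<lambda>t. Poly_Mapping.single t 1"])
    fix c t assume "(\<Sum>t\<in>?T. smult_mpoly (c t) (Poly_Mapping.single t 1)) \<in> {0 :: ('v, 'k) mpoly}" "t \<in> ?T"
    then show "c t = 0"
      using sum_smult_single[OF finite_mdeg, of c i t] by simp
  next
    fix f :: "('v, 'k) mpoly" assume f: "f \<in> forms i"
    have "f - (\<Sum>t\<in>?T. smult_mpoly (Poly_Mapping.lookup f t) (Poly_Mapping.single t 1)) = 0"
      using f by (intro poly_mapping_eqI)
        (auto simp: lookup_minus sum_smult_single[OF finite_mdeg] forms_iff_mdeg)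
    then show "\<exists>c. f - (\<Sum>t\<in>?T. smult_mpoly (c t) (Poly_Mapping.single t 1)) \<in> {0}"
      by (intro exI) simp
  qed (simp_all add: finite_mdeg forms_single)
  then show ?thesis by (simp add: card_mdeg)
qed

text \<open>A monomial of degree \<open>i\<close> with off-degree below \<open>m\<close> has
  exponent at least \<open>i - (m - 1)\<close> at \<open>v\<close>; dividing by that power leaves an
  arbitrary monomial of degree \<open>m - 1\<close>.\<close>

lemma card_mdeg_off_degree:
  assumes "m \<ge> 1" and "i \<ge> m - 1"
  shows "card {t :: 'v::finite \<Rightarrow>\<^sub>0 nat. mdeg t = i \<and> off_degree v t < m}
    = card {t :: 'v \<Rightarrow>\<^sub>0 nat. mdeg t = m - 1}"
proof -
  let ?u = "Poly_Mapping.single v (i - (m - 1))"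
  have "(\<lambda>t. ?u + t) ` {t. mdeg t = m - 1} = {t. mdeg t = i \<and> off_degree v t < m}"
  proof (intro set_eqI iffI)
    fix s assume "s \<in> (\<lambda>t. ?u + t) ` {t. mdeg t = m - 1}"
    then obtain t where "s = ?u + t" "mdeg t = m - 1" by blast
    then show "s \<in> {t. mdeg t = i \<and> off_degree v t < m}"
      using assms mdeg_eq_off_degree[of t v] by (auto simp: mdeg_add off_degree_add)
  next
    fix s assume s: "s \<in> {t. mdeg t = i \<and> off_degree v t < m}"
    then have "i - (m - 1) \<le> Poly_Mapping.lookup s v"
      using mdeg_eq_off_degree[of s v] assms by auto
    then have eq: "s = ?u + (s - ?u)"
      by (intro poly_mapping_eqI) (auto simp: lookup_add lookup_minus lookup_single when_def)
    then have "mdeg s = (i - (m - 1)) + mdeg (s - ?u)"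
      by (metis mdeg_add mdeg_single)
    then show "s \<in> (\<lambda>t. ?u + t) ` {t. mdeg t = m - 1}"
      using s assms eq by (intro image_eqI[of _ _ "s - ?u"]) auto
  qed
  then have "card {t. mdeg t = i \<and> off_degree v t < m} = card ((\<lambda>t. ?u + t) ` {t. mdeg t = m - 1})"
    by simp
  also have "\<dots> = card {t :: 'v \<Rightarrow>\<^sub>0 nat. mdeg t = m - 1}"
    by (rule card_image) (simp add: inj_on_def)
  finally show ?thesis .
qed

text \<open>In translated coordinates the monomials of off-degree below \<open>m\<close> are a basis
  of the quotient, and from degree \<open>m - 1\<close> on their number is constant.\<close>

lemma (in normalized_point) hilbert_fun_ideal_pow:
  assumes "m \<ge> 1" and "i \<ge> m - 1"
  shows "hilbert_fun (ideal_pow (vanishing_ideal {Q}) m) i = (CARD('v) - 1 + m - 1) choose (CARD('v) - 1)"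
proof -
  let ?T = "{t :: 'v \<Rightarrow>\<^sub>0 nat. mdeg t = i \<and> off_degree v t < m}"
  let ?h = "csubst (translation v (\<lambda>w. - q w))"
  have fin: "finite ?T" by (rule finite_subset[OF _ finite_mdeg[of i]]) auto
  have sum: "(\<Sum>t\<in>?T. smult_mpoly (c t) (?h (Poly_Mapping.single t 1)))
      = ?h (\<Sum>t\<in>?T. smult_mpoly (c t) (Poly_Mapping.single t 1))" for c
    by (simp add: csubst.psubst_sum csubst_smult)
  have "hilbert_fun (ideal_pow (vanishing_ideal {Q}) m) i = card ?T"
  proof (rule hilbert_fun_eqI[where g = "\<lambda>t. ?h (Poly_Mapping.single t 1)"])
    fix c t assume "(\<Sum>t\<in>?T. smult_mpoly (c t) (?h (Poly_Mapping.single t 1)))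
      \<in> ideal_pow (vanishing_ideal {Q}) m" and t: "t \<in> ?T"
    then have "(\<Sum>t\<in>?T. smult_mpoly (c t) (Poly_Mapping.single t 1)) \<in> axis_pow v m"
      by (simp only: sum ideal_pow_iff translation_inverse(2))
    moreover have "\<not> m \<le> off_degree v t" using t by simp
    ultimately have "Poly_Mapping.lookup (\<Sum>t\<in>?T. smult_mpoly (c t) (Poly_Mapping.single t 1)) t = 0"
      unfolding axis_pow_def mem_Collect_eq by blast
    then show "c t = 0"
      using t by (simp add: sum_smult_single[OF fin])
  next
    fix f :: "('v, 'k) mpoly" assume f: "f \<in> forms i"
    let ?f = "csubst (translation v q) f"
    have f': "?f \<in> forms i"
      by (rule csubst_forms[OF translation_forms f])
    have "?f - (\<Sum>t\<in>?T. smult_mpoly (Poly_Mapping.lookup ?f t) (Poly_Mapping.single t 1)) \<in> axis_pow v m"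
      unfolding axis_pow_def using f'
      by (auto simp: lookup_minus sum_smult_single[OF fin] forms_iff_mdeg split: if_splits)
    then have "?h (?f - (\<Sum>t\<in>?T. smult_mpoly (Poly_Mapping.lookup ?f t) (Poly_Mapping.single t 1)))
      \<in> ideal_pow (vanishing_ideal {Q}) m"
      unfolding ideal_pow_iff translation_inverse(2) .
    then have "f - (\<Sum>t\<in>?T. smult_mpoly (Poly_Mapping.lookup ?f t) (?h (Poly_Mapping.single t 1)))
      \<in> ideal_pow (vanishing_ideal {Q}) m"
      unfolding sum csubst.psubst_diff translation_inverse(1) .
    then show "\<exists>c. f - (\<Sum>t\<in>?T. smult_mpoly (c t) (?h (Poly_Mapping.single t 1)))
      \<in> ideal_pow (vanishing_ideal {Q}) m" by (rule exI[of _ "Poly_Mapping.lookup ?f"])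
  qed (use fin in \<open>auto intro!: subspace_ideal_pow csubst_forms translation_forms forms_single\<close>)
  also have "\<dots> = (m - 1 + CARD('v) - 1) choose (m - 1)"
    by (simp add: card_mdeg_off_degree[OF assms] card_mdeg)
  also have "\<dots> = (CARD('v) - 1 + m - 1) choose (CARD('v) - 1)"
    using assms(1) binomial_symmetric[of "m - 1" "m - 1 + (CARD('v) - 1)"]
    by (cases m; cases "CARD('v)") (auto simp: add.commute)
  finally show ?thesis .
qed

text \<open>The degree of one point of multiplicity \<open>m\<close>; the type argument carries the
  number of variables.\<close>

definition point_degree :: "'v::finite itself \<Rightarrow> nat \<Rightarrow> nat" where
  "point_degree _ m = (CARD('v) - 1 + m - 1) choose (CARD('v) - 1)"

lemma hilbert_fun_point:
  fixes Q :: "('v::finite \<Rightarrow> 'k::field) set"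
  assumes "Q \<in> proj_space" and "m \<ge> 1" and "i \<ge> m - 1"
  shows "hilbert_fun (ideal_pow (vanishing_ideal {Q}) m) i = point_degree TYPE('v) m"
proof -
  obtain q v where q: "q v = 1" "Q = {\<lambda>w. a * q w |a. a \<noteq> (0::'k)}"
    using proj_space_rep[OF assms(1)] .
  then interpret normalized_point Q q v by unfold_locales
  show ?thesis
    unfolding point_degree_def by (rule hilbert_fun_ideal_pow[OF assms(2,3)])
qed

lemma form_in_vanishing_ideal:
  "s \<in> forms i \<Longrightarrow> \<forall>Q\<in>S. \<forall>x\<in>Q. eval_mpoly s x = 0 \<Longrightarrow> s \<in> vanishing_ideal S"
  unfolding vanishing_ideal_def by (intro ideal.span_base) auto

lemma power_in_ideal_pow: "a \<in> I \<Longrightarrow> a ^ m \<in> ideal_pow I m"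
  using ideal_pow_power_mult[of a I 1 0 m] by simp

text \<open>Points are added one at a time. The form \<open>s\<close> vanishes to order
  \<open>m\<close> on \<open>S\<close> but not at \<open>Q\<close>. It is a nonzerodivisor modulo
  \<open>?I\<close>, whose Hilbert function is eventually constant, so the quotient by
  \<open>?I + (s)\<close> is 0 in large degrees. Thus \<open>?I + ?J\<close> contains all forms of
  such a degree, and the Hilbert functions add.\<close>

lemma hilbert_fun_fat_points_eventually:
  fixes S :: "('v::finite \<Rightarrow> 'k::field) set set"
  assumes "finite S" and "S \<subseteq> proj_space" and m: "m \<ge> 1"
  shows "\<exists>N. \<forall>i\<ge>N. hilbert_fun (\<Inter>Q\<in>S. ideal_pow (vanishing_ideal {Q}) m) i
    = card S * point_degree TYPE('v) m"
  using assms(1,2)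
proof (induction S rule: finite_induct)
  case empty
  \<comment> \<open>The empty intersection is the whole ring.\<close>
  show ?case
    by (simp add: hilbert_fun_eq_0_iff)
next
  case (insert Q S)
  let ?I = "ideal_pow (vanishing_ideal {Q}) m" and ?J = "\<Inter>Q\<in>S. ideal_pow (vanishing_ideal {Q}) m"
  from insert obtain N where N: "\<And>i. i \<ge> N \<Longrightarrow> hilbert_fun ?J i = card S * point_degree TYPE('v) m"
    by auto
  have hI: "homogeneous_ideal ?I" and hJ: "homogeneous_ideal ?J"
    by (auto intro: homogeneous_INT homogeneous_ideal_pow homogeneous_vanishing_ideal)
  have sI: "ideal.subspace ?I" and sJ: "ideal.subspace ?J"
    using hI hJ homogeneous_ideal_subspace by auto
  obtain s0 where s0: "s0 \<in> forms (card S)" "\<forall>x\<in>Q. eval_mpoly s0 x \<noteq> 0"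
    "\<forall>Q'\<in>S. \<forall>x\<in>Q'. eval_mpoly s0 x = 0"
    using exists_separating_form[of S Q] insert by auto
  define s where "s = s0 ^ m"
  define D where "D = m * card S"
  have s: "s \<in> forms D"
    unfolding s_def D_def by (rule forms_power[OF s0(1)])
  have sQ: "\<forall>x\<in>Q. eval_mpoly s x \<noteq> 0"
    using s0(2) by (simp add: s_def eval.psubst_power)
  have sJ': "s \<in> ?J"
    unfolding s_def using form_in_vanishing_ideal[OF s0(1)] s0(3) by (auto intro!: power_in_ideal_pow)
  have Qp: "Q \<in> proj_space" using insert.prems by simp
  \<comment> \<open>The bound \<open>D + m\<close> makes both \<open>i\<close> and
    \<open>i - D\<close> at least \<open>m - 1\<close>, where the Hilbert function of
    \<open>?I\<close> is constant; \<open>N\<close> takes care of \<open>?J\<close>.\<close>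
  have "hilbert_fun (\<Inter>Q\<in>insert Q S. ideal_pow (vanishing_ideal {Q}) m) i
      = card (insert Q S) * point_degree TYPE('v) m" if i: "i \<ge> max N (D + m)" for i
  proof -
    have eq: "i - D + D = i" using i by simp
    have "hilbert_fun (ideal.span (insert s ?I)) (i - D + D) + hilbert_fun ?I (i - D)
        = hilbert_fun ?I (i - D + D)"
      by (rule hilbert_fun_span_insert[OF hI s]) (rule point_ideal_pow_cancel[OF Qp s sQ])
    then have "hilbert_fun (ideal.span (insert s ?I)) i = 0"
      using i by (simp add: eq hilbert_fun_point[OF Qp m])
    then have *: "forms i \<subseteq> ideal.span (insert s ?I)"
      by (simp add: hilbert_fun_eq_0_iff)
    have "hilbert_fun (?I \<inter> ?J) i = hilbert_fun ?I i + hilbert_fun ?J i"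
    proof (rule hilbert_fun_Int[OF hI hJ])
      fix f :: "('v, 'k) mpoly" assume "f \<in> forms i"
      then obtain k where "f - k * s \<in> ?I"
        using * mem_span_insert[OF sI] by blast
      then show "\<exists>a\<in>?I. f - a \<in> ?J"
        using ideal.subspace_scale[OF sJ sJ', of k] by (intro bexI[of _ "f - k * s"]) auto
    qed
    then show ?thesis
      using i N insert.hyps by (simp add: hilbert_fun_point[OF Qp m])
  qed
  then show ?case by blast
qed

section \<open>Hilbert series of regular sequences\<close>

text \<open>The coefficients are integers so that the factors \<open>1 - fps_X ^ d\<close> are
  available.\<close>

definition hilbert_series :: "('v::finite, 'k::field) mpoly set \<Rightarrow> int fps" where
  "hilbert_series I = Abs_fps (\<lambda>i. int (hilbert_fun I i))"

lemma hilbert_series_span_insert: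
  fixes I :: "('v::finite, 'k::field) mpoly set"
  assumes I: "homogeneous_ideal I" and f: "f \<in> forms d" and cancel: "\<And>g. f * g \<in> I \<Longrightarrow> g \<in> I"
  shows "hilbert_series (ideal.span (insert f I)) = hilbert_series I * (1 - fps_X ^ d)"
proof (rule fps_ext)
  fix j
  show "fps_nth (hilbert_series (ideal.span (insert f I))) j
      = fps_nth (hilbert_series I * (1 - fps_X ^ d)) j"
  proof (cases "j < d")
    case True
    then show ?thesis
      by (simp add: hilbert_series_def right_diff_distrib fps_X_power_mult_right_nth
          hilbert_fun_span_insert_less[OF I f])
  next
    case False
    then have "int (hilbert_fun (ideal.span (insert f I)) j) + int (hilbert_fun I (j - d)) = int (hilbert_fun I j)"
      using hilbert_fun_span_insert[OF I f cancel, of "j - d"] by (simp flip: of_nat_add)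
    then show ?thesis
      using False by (simp add: hilbert_series_def right_diff_distrib fps_X_power_mult_right_nth)
  qed
qed

text \<open>By Pascal's rule, multiplication by \<open>1 - fps_X\<close> lowers \<open>n\<close> by
  one.\<close>

lemma binomial_series_mult_power:
  "Abs_fps (\<lambda>i. int ((i + n) choose i)) * (1 - fps_X) ^ Suc n = 1"
proof (induction n)
  case 0
  show ?case
    by (rule fps_ext) (simp add: right_diff_distrib)
next
  case (Suc n)
  have "Abs_fps (\<lambda>i. int ((i + Suc n) choose i)) * (1 - fps_X) = Abs_fps (\<lambda>i. int ((i + n) choose i))"
  proof (rule fps_ext)
    fix j
    show "fps_nth (Abs_fps (\<lambda>i. int ((i + Suc n) choose i)) * (1 - fps_X)) j
      = fps_nth (Abs_fps (\<lambda>i. int ((i + n) choose i))) j"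
      by (cases j) (simp_all add: right_diff_distrib)
  qed
  then have "Abs_fps (\<lambda>i. int ((i + Suc n) choose i)) * (1 - fps_X) ^ Suc (Suc n)
      = Abs_fps (\<lambda>i. int ((i + n) choose i)) * (1 - fps_X) ^ Suc n"
    by (simp only: power_Suc[of _ "Suc n"] mult.assoc[symmetric])
  with Suc show ?case by (simp only:)
qed

lemma hilbert_series_zero_ideal:
  "hilbert_series ({0} :: ('v::finite, 'k::field) mpoly set) * (1 - fps_X) ^ CARD('v) = 1"
proof -
  obtain n where n: "CARD('v) = Suc n"
    using not0_implies_Suc[of "CARD('v)"] by auto
  show ?thesis
    using binomial_series_mult_power[of n]
    by (simp only: n hilbert_series_def hilbert_fun_zero_ideal add_Suc_right diff_Suc_1)
qed

lemma span_insert_span: "ideal.span (insert f (ideal.span S)) = ideal.span (insert f S)"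
proof (rule antisym)
  show "ideal.span (insert f (ideal.span S)) \<subseteq> ideal.span (insert f S)"
    by (rule ideal.span_minimal)
      (auto intro: ideal.span_base subsetD[OF ideal.span_mono[of S "insert f S"]])
qed (rule ideal.span_mono, auto intro: ideal.span_base)

text \<open>Each form is a nonzerodivisor modulo its predecessors and therefore contributes one
  factor.\<close>

lemma hilbert_series_regular:
  fixes F :: "nat \<Rightarrow> ('v::finite, 'k::field) mpoly"
  assumes "\<And>i. i \<in> {1..r} \<Longrightarrow> F i \<in> forms (e i)"
    and "\<And>i g. i \<in> {1..r} \<Longrightarrow> F i * g \<in> ideal.span (F ` {1..<i}) \<Longrightarrow> g \<in> ideal.span (F ` {1..<i})"
  shows "hilbert_series (ideal.span (F ` {1..r}))
    = hilbert_series ({0} :: ('v, 'k) mpoly set) * (\<Prod>i=1..r. 1 - fps_X ^ e i)"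
  using assms
proof (induction r)
  case (Suc r)
  have r: "{1..<Suc r} = {1..r}" by auto
  have "F ` {1..Suc r} = insert (F (Suc r)) (F ` {1..r})"
    by (simp add: atLeastAtMostSuc_conv)
  then have "ideal.span (F ` {1..Suc r}) = ideal.span (insert (F (Suc r)) (ideal.span (F ` {1..r})))"
    by (simp only: span_insert_span)
  also have "hilbert_series \<dots> = hilbert_series (ideal.span (F ` {1..r})) * (1 - fps_X ^ e (Suc r))"
  proof (rule hilbert_series_span_insert)
    show "homogeneous_ideal (ideal.span (F ` {1..r}))"
    proof (rule homogeneous_span_forms)
      fix f assume "f \<in> F ` {1..r}"
      then obtain i where "i \<in> {1..r}" "f = F i" by auto
      then have "f \<in> forms (e i)" using Suc.prems(1)[of i] by simp
      then show "\<exists>i. f \<in> forms i" ..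
    qed
    show "F (Suc r) \<in> forms (e (Suc r))"
      using Suc.prems(1)[of "Suc r"] by simp
    show "g \<in> ideal.span (F ` {1..r})" if "F (Suc r) * g \<in> ideal.span (F ` {1..r})" for g
      using Suc.prems(2)[of "Suc r" g] that unfolding r by simp
  qed
  also have "hilbert_series (ideal.span (F ` {1..r}))
      = hilbert_series ({0} :: ('v, 'k) mpoly set) * (\<Prod>i=1..r. 1 - fps_X ^ e i)"
    using Suc.prems by (intro Suc.IH) auto
  finally show ?case
    by (simp add: mult.assoc del: ideal.scale_scale)
qed simp

text \<open>Nonnegativity of all coefficients rules out cancellation in products, so that the ranges
  of positivity add up.\<close>

definition positive_upto :: "int fps \<Rightarrow> nat \<Rightarrow> bool" where
  "positive_upto f a \<longleftrightarrow> (\<forall>k. fps_nth f k \<ge> 0) \<and> (\<forall>k\<le>a. fps_nth f k > 0)"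

lemma positive_upto_mult:
  assumes f: "positive_upto f a" and g: "positive_upto g b"
  shows "positive_upto (f * g) (a + b)"
  unfolding positive_upto_def fps_mult_nth
proof (intro conjI allI impI)
  fix k
  show "0 \<le> (\<Sum>i=0..k. fps_nth f i * fps_nth g (k - i))"
    using f g by (intro sum_nonneg mult_nonneg_nonneg) (auto simp: positive_upto_def)
next
  fix k assume k: "k \<le> a + b"
  \<comment> \<open>\<open>min a k\<close> splits \<open>k\<close> into a part at most
    \<open>a\<close> and a part at most \<open>b\<close>, which gives one positive term of the
    convolution.\<close>
  have "fps_nth f (min a k) * fps_nth g (k - min a k) > 0"
    using f g k unfolding positive_upto_def by (intro mult_pos_pos) auto
  then show "0 < (\<Sum>i=0..k. fps_nth f i * fps_nth g (k - i))"
    using f g by (intro sum_pos2[of _ "min a k"] mult_nonneg_nonneg) (auto simp: positive_upto_def)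
qed

lemma positive_upto_prod:
  assumes "finite A" and "\<And>x. x \<in> A \<Longrightarrow> positive_upto (f x) (a x)"
  shows "positive_upto (\<Prod>x\<in>A. f x) (\<Sum>x\<in>A. a x)"
  using assms
  by (induction A rule: finite_induct) (auto simp: positive_upto_mult, simp add: positive_upto_def)

lemma positive_upto_geometric: "c \<ge> 1 \<Longrightarrow> positive_upto (\<Sum>j<c. fps_X ^ j) (c - 1)"
  by (auto simp: positive_upto_def fps_sum_nth fps_X_power_nth)

section \<open>Complete intersections of points\<close>

lemma cancel_power:
  assumes "\<And>h. g * h \<in> A \<Longrightarrow> h \<in> A" and "g ^ j * h \<in> A"
  shows "h \<in> (A :: 'a::comm_ring_1 set)"
  using assms(2)
proof (induction j)
  case (Suc j)
  then have "g * (g ^ j * h) \<in> A" by (simp only: power_Suc mult.assoc)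
  then show ?case using assms(1) Suc.IH by blast
qed simp

text \<open>Induction on \<open>j\<close>. If \<open>s * f\<close> is congruent to
  \<open>k * g ^ Suc j\<close> modulo \<open>A\<close>, the induction hypothesis makes
  \<open>f\<close> congruent to some \<open>c * g ^ j\<close>. Cancelling \<open>g ^ j\<close> puts
  \<open>s * c\<close>, hence \<open>c\<close>, into \<open>A + (g)\<close>, and so \<open>f\<close>
  into \<open>A + (g ^ Suc j)\<close>.\<close>

lemma cancel_span_insert_power:
  fixes A :: "('v::finite, 'k::field) mpoly set"
  assumes A: "ideal.subspace A" and g: "\<And>h. g * h \<in> A \<Longrightarrow> h \<in> A"
    and s: "\<And>h. s * h \<in> ideal.span (insert g A) \<Longrightarrow> h \<in> ideal.span (insert g A)"
    and "s * f \<in> ideal.span (insert (g ^ j) A)"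
  shows "f \<in> ideal.span (insert (g ^ j) A)"
  using assms(4)
proof (induction j arbitrary: f)
  case 0
  have "f * 1 \<in> ideal.span (insert 1 A)"
    by (intro ideal.span_scale ideal.span_base) simp
  then show ?case by simp
next
  case (Suc j)
  obtain k where k: "s * f - k * g ^ Suc j \<in> A"
    using Suc.prems mem_span_insert[OF A] by blast
  then have "s * f - (k * g) * g ^ j \<in> A"
    by (simp only: power_Suc mult.assoc)
  then have "f \<in> ideal.span (insert (g ^ j) A)"
    using Suc.IH mem_span_insert[OF A] by blast
  then obtain c where c: "f - c * g ^ j \<in> A"
    using mem_span_insert[OF A] by blast
  have "(s * f - k * g ^ Suc j) - s * (f - c * g ^ j) \<in> A"
    by (intro ideal.subspace_diff[OF A] ideal.subspace_scale[OF A] k c)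
  also have "(s * f - k * g ^ Suc j) - s * (f - c * g ^ j) = g ^ j * (s * c - k * g)"
    by (simp add: algebra_simps del: ideal.scale_scale)
  finally have "s * c - k * g \<in> A"
    using cancel_power[of g A, OF g] by blast
  then have "c \<in> ideal.span (insert g A)"
    using s mem_span_insert[OF A] by blast
  then obtain l where l: "c - l * g \<in> A"
    using mem_span_insert[OF A] by blast
  have "(f - c * g ^ j) + g ^ j * (c - l * g) \<in> A"
    by (intro ideal.subspace_add[OF A] ideal.subspace_scale[OF A] l c)
  also have "(f - c * g ^ j) + g ^ j * (c - l * g) = f - l * g ^ Suc j"
    by (simp add: algebra_simps del: ideal.scale_scale)
  finally show ?case
    using mem_span_insert[OF A] by blast
qed

text \<open>Modulo \<open>A\<close>, a product of \<open>m\<close> elements of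
  \<open>A + (g)\<close> is a product of \<open>m\<close> multiples of \<open>g\<close>.\<close>

lemma ideal_pow_span_insert:
  fixes A :: "('v::finite, 'k::field) mpoly set"
  assumes A: "ideal.subspace A"
  shows "ideal_pow (ideal.span (insert g A)) m \<subseteq> ideal.span (insert (g ^ m) A)"
proof (induction m)
  case 0
  have "f * 1 \<in> ideal.span (insert 1 A)" for f
    by (intro ideal.span_scale ideal.span_base) simp
  then show ?case by auto
next
  case (Suc m)
  show ?case
    unfolding ideal_pow.simps
  proof (rule ideal.span_minimal)
    show "{a * b |a b. a \<in> ideal.span (insert g A) \<and> b \<in> ideal_pow (ideal.span (insert g A)) m}
      \<subseteq> ideal.span (insert (g ^ Suc m) A)"
    proof
      fix x assume "x \<in> {a * b |a b. a \<in> ideal.span (insert g A) \<and> b \<in> ideal_pow (ideal.span (insert g A)) m}"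
      then obtain a b where x: "x = a * b" and a: "a \<in> ideal.span (insert g A)"
        and b: "b \<in> ideal.span (insert (g ^ m) A)"
        using Suc.IH by blast
      obtain k where k: "a - k * g \<in> A" using a mem_span_insert[OF A] by blast
      obtain l where l: "b - l * g ^ m \<in> A" using b mem_span_insert[OF A] by blast
      have "b * (a - k * g) + (k * g) * (b - l * g ^ m) \<in> A"
        by (intro ideal.subspace_add[OF A] ideal.subspace_scale[OF A] k l)
      also have "b * (a - k * g) + (k * g) * (b - l * g ^ m) = x - (k * l) * g ^ Suc m"
        by (simp add: x algebra_simps del: ideal.scale_scale)
      finally show "x \<in> ideal.span (insert (g ^ Suc m) A)"
        using mem_span_insert[OF A] by blast
    qed
  qed simp
qed

text \<open>One factor \<open>s\<close> is spent on each of the \<open>m\<close> factors taken from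
  \<open>A\<close>.\<close>

lemma power_mult_ideal_pow:
  fixes s :: "'a::comm_ring_1"
  assumes "\<And>p. p \<in> A \<Longrightarrow> s * p \<in> I" and "f \<in> ideal_pow A m"
  shows "s ^ m * f \<in> ideal_pow I m"
  using assms(2)
proof (induction m arbitrary: f)
  case (Suc m)
  from Suc.prems show ?case
    unfolding ideal_pow.simps(2)[of A]
  proof (induction rule: ideal.span_induct_alt)
    case base
    show ?case by (simp add: ideal.span_zero)
  next
    case (step c x y)
    then obtain a b where x: "x = a * b" "a \<in> A" "b \<in> ideal_pow A m" by blast
    have "s ^ Suc m * (c * x + y) = c * ((s * a) * (s ^ m * b)) + s ^ Suc m * y"
      by (simp add: x algebra_simps del: ideal.scale_scale)
    also have "\<dots> \<in> ideal_pow I (Suc m)"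
      using ideal_pow_mult[OF assms(1)[OF x(2)] Suc.IH[OF x(3)]] step.IH
      by (intro ideal.subspace_add[OF subspace_ideal_pow]
          ideal.subspace_scale[OF subspace_ideal_pow, of "s * a * (s ^ m * b)"])
    finally show ?case .
  qed
qed simp

lemma exists_separating_family:
  fixes S :: "('v::finite \<Rightarrow> 'k::field) set set"
  assumes "finite S" and "S \<subseteq> proj_space"
  obtains s where "\<And>Q. Q \<in> S \<Longrightarrow> s Q \<in> forms (card S - 1)"
    and "\<And>Q x. Q \<in> S \<Longrightarrow> x \<in> Q \<Longrightarrow> eval_mpoly (s Q) x \<noteq> 0"
    and "\<And>Q Q' x. Q \<in> S \<Longrightarrow> Q' \<in> S \<Longrightarrow> Q' \<noteq> Q \<Longrightarrow> x \<in> Q' \<Longrightarrow> eval_mpoly (s Q) x = 0"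
proof -
  have "\<exists>s. s \<in> forms (card S - 1) \<and> (\<forall>x\<in>Q. eval_mpoly s x \<noteq> 0)
    \<and> (\<forall>Q'\<in>S - {Q}. \<forall>x\<in>Q'. eval_mpoly s x = 0)" if "Q \<in> S" for Q
    using exists_separating_form[of "S - {Q}" Q] assms that by (auto simp: card_Diff_singleton)
  then obtain s where s: "\<And>Q. Q \<in> S \<Longrightarrow> s Q \<in> forms (card S - 1) \<and> (\<forall>x\<in>Q. eval_mpoly (s Q) x \<noteq> 0)
    \<and> (\<forall>Q'\<in>S - {Q}. \<forall>x\<in>Q'. eval_mpoly (s Q) x = 0)"
    by metis
  show thesis
    by (rule that[of s]) (use s in auto)
qed

text \<open>At \<open>Q\<close> only its own summand survives; \<open>k \<ge> 1\<close> enters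
  because \<open>0 ^ 0 = 1\<close>. For a separating family the sum thus vanishes at no point of
  \<open>S\<close>, without any generic choice.\<close>

lemma eval_sum_separating:
  assumes "finite S" and "Q \<in> S" and "x \<in> Q" and "k \<ge> 1"
    and "\<And>Q' x. Q' \<in> S \<Longrightarrow> Q \<noteq> Q' \<Longrightarrow> x \<in> Q \<Longrightarrow> eval_mpoly (s Q') x = 0"
  shows "eval_mpoly (\<Sum>Q\<in>S. s Q ^ k) x = eval_mpoly (s Q) x ^ k"
proof -
  have "eval_mpoly (\<Sum>Q\<in>S. s Q ^ k) x = (\<Sum>Q'\<in>S. if Q' = Q then eval_mpoly (s Q) x ^ k else 0)"
    unfolding eval.psubst_sum
    by (intro sum.cong) (use assms in \<open>auto simp: eval.psubst_power power_0_left\<close>)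
  then show ?thesis
    using assms(1,2) by simp
qed

locale complete_intersection =
  fixes X :: "('v::finite \<Rightarrow> 'k::field_char_0) set set" and n m :: nat and e :: "nat \<Rightarrow> nat"
    and F :: "nat \<Rightarrow> ('v, 'k) mpoly"
  assumes dim: "CARD('v) = n + 1" and n: "n \<ge> 1" and m: "m \<ge> 1"
    and e: "\<And>i. i \<in> {1..n} \<Longrightarrow> e i \<ge> 1"
    and X: "X \<subseteq> proj_space" "finite X"
    and F: "\<And>i. i \<in> {1..n} \<Longrightarrow> F i \<in> forms (e i)"
    and regular: "regular_sequence n F"
    and ideal_X: "vanishing_ideal X = ideal.span (F ` {1..n})"
begin

definition A where "A = ideal.span (F ` {1..n - 1})"

text \<open>Contains the \<open>m\<close>-th power of the ideal of \<open>X\<close> and is itself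
  generated by a regular sequence of \<open>n\<close> forms, so its Hilbert series is
  explicit.\<close>

definition V where "V = ideal.span (insert (F n ^ m) A)"

lemma A_alt: "A = ideal.span (F ` {1..<n})"
proof -
  have "{1..n - 1} = {1..<n}" using n by auto
  then show ?thesis by (simp only: A_def)
qed

lemma subspace_A: "ideal.subspace A"
  by (simp add: A_def)

lemma homogeneous_A: "homogeneous_ideal A"
  unfolding A_def
proof (rule homogeneous_span_forms)
  fix f assume "f \<in> F ` {1..n - 1}"
  then obtain i where i: "i \<in> {1..n - 1}" "f = F i" by blast
  then have "i \<in> {1..n}" by auto
  then have "f \<in> forms (e i)" using F i(2) by simp
  then show "\<exists>i. f \<in> forms i" ..
qed

lemma power_form: "F n ^ m \<in> forms (m * e n)"
  using F[of n] n by (intro forms_power) simp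

lemma homogeneous_V: "homogeneous_ideal V"
  unfolding V_def by (rule homogeneous_span_insert[OF homogeneous_A power_form])

lemma vanishing_ideal_eq: "vanishing_ideal X = ideal.span (insert (F n) A)"
proof -
  have "{1..n} = insert n {1..<n}" using n by auto
  then have "F ` {1..n} = insert (F n) (F ` {1..<n})" by (simp only: image_insert)
  then show ?thesis
    by (simp only: ideal_X A_alt span_insert_span)
qed

lemma cancel_F: "i \<in> {1..n} \<Longrightarrow> F i * g \<in> ideal.span (F ` {1..<i}) \<Longrightarrow> g \<in> ideal.span (F ` {1..<i})"
  using regular by (auto simp: regular_sequence_def)

lemma cancel_Fn: "F n * g \<in> A \<Longrightarrow> g \<in> A"
  using cancel_F[of n g] n by (simp add: A_alt)

text \<open>Modulo the ideal of \<open>X\<close> cancellation is pointwise, as that ideal consists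
  of all polynomials vanishing on \<open>X\<close>; it then passes from \<open>F n\<close> to
  \<open>F n ^ m\<close>.\<close>

lemma cancel_V:
  assumes s: "\<And>Q x. Q \<in> X \<Longrightarrow> x \<in> Q \<Longrightarrow> eval_mpoly s x \<noteq> 0" and "s * f \<in> V"
  shows "f \<in> V"
  unfolding V_def
proof (rule cancel_span_insert_power[OF subspace_A, where s = s])
  fix h assume "s * h \<in> ideal.span (insert (F n) A)"
  then show "h \<in> ideal.span (insert (F n) A)"
    unfolding vanishing_ideal_eq[symmetric] vanishing_ideal_iff[OF X(1)]
    using s by (auto simp: eval.psubst_mult)
qed (use cancel_Fn assms(2) in \<open>auto simp: V_def\<close>)

text \<open>Each \<open>s Q\<close> carries the ideal of \<open>Q\<close> into that of
  \<open>X\<close>, so \<open>s Q ^ m * f\<close> lies in the \<open>m\<close>-th power of the ideal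
  of \<open>X\<close>. Summing over \<open>Q\<close> gives \<open>u * f\<close> in \<open>V\<close>,
  and \<open>u\<close>, which vanishes nowhere on \<open>X\<close>, can be cancelled.\<close>

lemma symbolic_power_subset: "(\<Inter>Q\<in>X. ideal_pow (vanishing_ideal {Q}) m) \<subseteq> V"
proof
  fix f assume f: "f \<in> (\<Inter>Q\<in>X. ideal_pow (vanishing_ideal {Q}) m)"
  obtain s where s: "\<And>Q. Q \<in> X \<Longrightarrow> s Q \<in> forms (card X - 1)"
    "\<And>Q x. Q \<in> X \<Longrightarrow> x \<in> Q \<Longrightarrow> eval_mpoly (s Q) x \<noteq> 0"
    "\<And>Q Q' x. Q \<in> X \<Longrightarrow> Q' \<in> X \<Longrightarrow> Q' \<noteq> Q \<Longrightarrow> x \<in> Q' \<Longrightarrow> eval_mpoly (s Q) x = 0"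
    using exists_separating_family[OF X(2,1)] by blast
  define u where "u = (\<Sum>Q\<in>X. s Q ^ m)"
  have u: "eval_mpoly u x \<noteq> 0" if "Q \<in> X" "x \<in> Q" for Q x
  proof -
    have "eval_mpoly u x = eval_mpoly (s Q) x ^ m"
      unfolding u_def by (rule eval_sum_separating[OF X(2) that m]) (use s(3) that(1) in auto)
    then show ?thesis using s(2) that by simp
  qed
  have "s Q ^ m * f \<in> ideal_pow (vanishing_ideal X) m" if Q: "Q \<in> X" for Q
  proof (rule power_mult_ideal_pow)
    show "f \<in> ideal_pow (vanishing_ideal {Q}) m" using f Q by blast
    show "s Q * p \<in> vanishing_ideal X" if "p \<in> vanishing_ideal {Q}" for p
    proof -
      have "{Q} \<subseteq> proj_space" using X Q by auto
      then have "\<forall>x\<in>Q. eval_mpoly p x = 0"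
        using that by (simp add: vanishing_ideal_iff)
      then show ?thesis
        unfolding vanishing_ideal_iff[OF X(1)] eval.psubst_mult using s(3) Q by (metis mult_eq_0_iff)
    qed
  qed
  then have "u * f \<in> ideal_pow (vanishing_ideal X) m"
    unfolding u_def sum_distrib_right by (rule ideal.subspace_sum[OF subspace_ideal_pow])
  then have "u * f \<in> V"
    unfolding V_def vanishing_ideal_eq using ideal_pow_span_insert[OF subspace_A] by blast
  with u show "f \<in> V" by (rule cancel_V)
qed

text \<open>Each of the \<open>n + 1\<close> generators contributes a factor
  \<open>1 - fps_X ^ c\<close>, which is \<open>1 - fps_X\<close> times a geometric sum with
  \<open>c\<close> terms. The factors \<open>1 - fps_X\<close> cancel the Hilbert series of the
  ring, and each geometric sum is positive up to degree \<open>c - 1\<close>.\<close>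

lemma hilbert_fun_V_pos:
  assumes s: "s \<in> forms D" "\<And>Q x. Q \<in> X \<Longrightarrow> x \<in> Q \<Longrightarrow> eval_mpoly s x \<noteq> 0" and D: "D \<ge> 1"
    and k: "k \<le> (\<Sum>i=1..n - 1. e i - 1) + (m * e n - 1) + (D - 1)"
  shows "hilbert_fun (ideal.span (insert s V)) k > 0"
proof -
  let ?P = "\<lambda>c. \<Sum>j<c. fps_X ^ j :: int fps"
  have geo: "1 - fps_X ^ c = (1 - fps_X) * ?P c" for c
    by (rule one_diff_power_eq)
  have "hilbert_series (ideal.span (insert s V)) = hilbert_series V * (1 - fps_X ^ D)"
    by (rule hilbert_series_span_insert[OF homogeneous_V s(1)]) (rule cancel_V[OF s(2)])
  also have "hilbert_series V = hilbert_series A * (1 - fps_X ^ (m * e n))"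
    unfolding V_def
    by (rule hilbert_series_span_insert[OF homogeneous_A power_form]) (rule cancel_power[OF cancel_Fn])
  also have "hilbert_series A = hilbert_series ({0} :: ('v, 'k) mpoly set) * (\<Prod>i=1..n - 1. 1 - fps_X ^ e i)"
    unfolding A_def by (rule hilbert_series_regular) (use F cancel_F in auto)
  also have "\<dots> = hilbert_series ({0} :: ('v, 'k) mpoly set) * (1 - fps_X) ^ (n - 1) * (\<Prod>i=1..n - 1. ?P (e i))"
    by (simp add: geo prod.distrib mult.assoc del: ideal.scale_scale)
  also have "\<dots> * (1 - fps_X ^ (m * e n)) * (1 - fps_X ^ D)
      = (hilbert_series ({0} :: ('v, 'k) mpoly set) * ((1 - fps_X) ^ (n - 1) * (1 - fps_X) * (1 - fps_X)))
        * ((\<Prod>i=1..n - 1. ?P (e i)) * ?P (m * e n) * ?P D)"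
    unfolding geo[of D] geo[of "m * e n"] by (simp only: ac_simps)
  \<comment> \<open>The exponents \<open>n - 1\<close>, 1 and 1 come from \<open>A\<close>,
    \<open>F n ^ m\<close> and \<open>s\<close>; they add up to the number of variables.\<close>
  also have "(1 - fps_X) ^ (n - 1) * (1 - fps_X) * (1 - fps_X) = (1 - fps_X :: int fps) ^ CARD('v)"
    using n by (simp add: dim power_Suc2[symmetric] del: power_Suc)
  also have "hilbert_series ({0} :: ('v, 'k) mpoly set) * (1 - fps_X) ^ CARD('v) = 1"
    by (rule hilbert_series_zero_ideal)
  finally have hs: "hilbert_series (ideal.span (insert s V))
      = (\<Prod>i=1..n - 1. ?P (e i)) * ?P (m * e n) * ?P D"
    by simp
  have "positive_upto (hilbert_series (ideal.span (insert s V)))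
      ((\<Sum>i=1..n - 1. e i - 1) + (m * e n - 1) + (D - 1))"
    unfolding hs using m e[of n] n D
    by (intro positive_upto_mult positive_upto_prod positive_upto_geometric e) auto
  then show ?thesis
    using k by (auto simp: positive_upto_def hilbert_series_def)
qed

end

text \<open>Multiplication by \<open>s\<close> makes the Hilbert function nondecreasing along the progression
  \<open>i, i + D, i + 2 D, ...\<close>, on which it ends up equal to the degree.\<close>

lemma fat_points_generated:
  fixes S :: "('v::finite \<Rightarrow> 'k::field) set set"
  assumes S: "finite S" "S \<subseteq> proj_space" and m: "m \<ge> 1"
    and s: "s \<in> forms D" "\<And>Q x. Q \<in> S \<Longrightarrow> x \<in> Q \<Longrightarrow> eval_mpoly s x \<noteq> 0" and D: "D \<ge> 1"
    and i: "hilbert_fun (\<Inter>Q\<in>S. ideal_pow (vanishing_ideal {Q}) m) i = card S * point_degree TYPE('v) m"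
  shows "forms (i + D) \<subseteq> ideal.span (insert s (\<Inter>Q\<in>S. ideal_pow (vanishing_ideal {Q}) m))"
proof -
  let ?I = "\<Inter>Q\<in>S. ideal_pow (vanishing_ideal {Q}) m"
  have hI: "homogeneous_ideal ?I"
    by (intro homogeneous_INT homogeneous_ideal_pow homogeneous_vanishing_ideal)
  have cancel: "g \<in> ?I" if "s * g \<in> ?I" for g
  proof
    fix Q assume Q: "Q \<in> S"
    have "Q \<in> proj_space" using S Q by auto
    from point_ideal_pow_cancel[OF this s(1)] show "g \<in> ideal_pow (vanishing_ideal {Q}) m"
      using s(2)[OF Q] that Q by blast
  qed
  have step: "hilbert_fun (ideal.span (insert s ?I)) (j + D) + hilbert_fun ?I j = hilbert_fun ?I (j + D)" for j
    by (rule hilbert_fun_span_insert[OF hI s(1) cancel])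
  obtain N where N: "\<And>i. i \<ge> N \<Longrightarrow> hilbert_fun ?I i = card S * point_degree TYPE('v) m"
    using hilbert_fun_fat_points_eventually[OF S m] by blast
  have "hilbert_fun ?I (i + D) \<le> hilbert_fun ?I (i + D + k * D)" for k
  proof (induction k)
    case (Suc k)
    also have "hilbert_fun ?I (i + D + k * D) \<le> hilbert_fun ?I (i + D + k * D + D)"
      using step[of "i + D + k * D"] by linarith
    finally show ?case by (simp add: add_ac)
  qed simp
  \<comment> \<open>Since \<open>D \<ge> 1\<close>, \<open>N\<close> steps of length
    \<open>D\<close> lead beyond \<open>N\<close>, where the Hilbert function equals the
    degree.\<close>
  from this[of N] have "hilbert_fun ?I (i + D) \<le> card S * point_degree TYPE('v) m"
    using N[of "i + D + N * D"] D by (simp add: trans_le_add2)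
  \<comment> \<open>The value at \<open>i + D\<close> is at most the degree, which is attained at
    \<open>i\<close> already; their difference is the dimension of the quotient by
    \<open>s\<close>.\<close>
  then have "hilbert_fun (ideal.span (insert s ?I)) (i + D) = 0"
    using step[of i] i by linarith
  then show ?thesis
    by (simp add: hilbert_fun_eq_0_iff)
qed

section \<open>Fat points of equal multiplicity and their regularity index\<close>

lemma fat_diff: "fat X m - {(P, m)} = fat (X - {P}) m"
  by (auto simp: fat_def)

lemma fat_ideal_fat: "fat_ideal (fat S m) = (\<Inter>Q\<in>S. ideal_pow (vanishing_ideal {Q}) m)"
  by (simp add: fat_ideal_def fat_def)

lemma fat_degree_fat: "fat_degree (fat S m :: ('v::finite, 'k::field) fat_points) = card S * point_degree TYPE('v) m"
  by (simp add: fat_degree_def fat_def point_degree_def sum.reindex inj_on_def)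

text \<open>Some degree attains the required value because the Hilbert function eventually equals
  the degree of the scheme, so the \<open>LEAST\<close> in \<open>reg_index\<close> has the
  property.\<close>

lemma hilbert_fun_reg_index:
  fixes S :: "('v::finite \<Rightarrow> 'k::field) set set"
  assumes "finite S" "S \<subseteq> proj_space" "m \<ge> 1"
  shows "hilbert_fun (\<Inter>Q\<in>S. ideal_pow (vanishing_ideal {Q}) m) (reg_index (fat S m))
    = card S * point_degree TYPE('v) m"
proof -
  have "\<exists>i. hilbert_fun (fat_ideal (fat S m)) i = fat_degree (fat S m)"
    using hilbert_fun_fat_points_eventually[OF assms] unfolding fat_ideal_fat fat_degree_fat by blast
  from LeastI_ex[OF this] show ?thesis
    by (simp only: reg_index_def fat_ideal_fat fat_degree_fat)
qed

theorem proposition5p7: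
  fixes X X1 X2 :: "('v::finite \<Rightarrow> 'k::{alg_closed_field, field_char_0}) set set"
    and P :: "('v \<Rightarrow> 'k) set"
    and Z Y :: "('v, 'k) fat_points"
    and d :: "nat \<Rightarrow> nat" and n m :: nat
  assumes "CARD('v) = n + 1" and "n \<ge> 2" and "m \<ge> 1"
    and "2 \<le> d 1" and "mono_on {1..n} d"
    and "CI_points n d X"
    and "CI_points n (d(1 := d 1 - 1)) X1" and "CI_points n (d(1 := 1)) X2"
    and "X = X1 \<union> X2" and "X1 \<inter> X2 = {}"
    and "P \<in> X2"
    and "Z = fat X m" and "Y = Z - {(P, m)}"
  shows "int (reg_index Y) \<ge> (\<Sum>i=1..n-1. int (d i)) + int m * int (d n) - (int n + 1)"
proof -
  let ?e = "d(1 := d 1 - 1)"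
  have X: "X \<subseteq> proj_space" "finite X"
    using assms(6) by (auto simp: CI_points_def)
  have X1: "X1 \<subseteq> proj_space" "finite X1" "card X1 = (\<Prod>i=1..n. ?e i)"
    using assms(7) by (auto simp: CI_points_def)
  obtain F where F: "regular_sequence n F" "\<And>i. i \<in> {1..n} \<Longrightarrow> F i \<in> forms (?e i)"
    "vanishing_ideal X1 = ideal.span (F ` {1..n})"
    using assms(7) unfolding CI_points_def by blast
  \<comment> \<open>The degrees are sorted, so all are at least 2, and lowering the first by 1 keeps
    the type of \<open>X1\<close> positive.\<close>
  have d2: "2 \<le> d i" if "i \<in> {1..n}" for i
    using mono_onD[OF assms(5), of 1 i] that assms(4) by auto
  have e1: "?e i \<ge> 1" if "i \<in> {1..n}" for i
    using d2[OF that] assms(4) by auto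
  interpret CI: complete_intersection X1 n m ?e F
    by unfold_locales (use assms e1 X1 F in auto)
  have "card X1 \<noteq> 0"
    unfolding X1(3) using e1 by (metis finite_atLeastAtMost not_one_le_zero prod_zero_iff)
  \<comment> \<open>Both parts are nonempty, \<open>X2\<close> because of \<open>P\<close>; this
    makes the degree \<open>D\<close> below positive.\<close>
  then have "card X \<ge> 2"
  proof -
    have "card X = card X1 + card X2"
      using assms(9,10) X by (simp add: card_Un_disjoint)
    moreover have "card X2 \<noteq> 0"
      using assms(9,11) X by auto
    ultimately show ?thesis using \<open>card X1 \<noteq> 0\<close> by linarith
  qed
  define D where "D = card X - 1"
  have D: "D \<ge> 1" using \<open>card X \<ge> 2\<close> by (simp add: D_def)
  obtain t where t: "\<And>Q. Q \<in> X \<Longrightarrow> t Q \<in> forms D"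
    "\<And>Q x. Q \<in> X \<Longrightarrow> x \<in> Q \<Longrightarrow> eval_mpoly (t Q) x \<noteq> 0"
    "\<And>Q Q' x. Q \<in> X \<Longrightarrow> Q' \<in> X \<Longrightarrow> Q' \<noteq> Q \<Longrightarrow> x \<in> Q' \<Longrightarrow> eval_mpoly (t Q) x = 0"
    using exists_separating_family[OF X(2,1)] unfolding D_def by blast
  define s where "s = (\<Sum>Q\<in>X. t Q ^ 1)"
  have s: "s \<in> forms D"
    unfolding s_def using t(1) by (intro forms_sum) simp
  have s0: "eval_mpoly s x \<noteq> 0" if "Q \<in> X" "x \<in> Q" for Q x
  proof -
    have "eval_mpoly s x = eval_mpoly (t Q) x ^ 1"
      unfolding s_def by (rule eval_sum_separating[OF X(2) that order_refl]) (use t(3) that(1) in auto)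
    then show ?thesis using t(2) that by simp
  qed
  let ?S = "X - {P}" and ?I = "\<Inter>Q\<in>X - {P}. ideal_pow (vanishing_ideal {Q}) m"
  have Y: "Y = fat ?S m"
    unfolding assms(12,13) by (rule fat_diff)
  define i where "i = reg_index Y"
  have S: "finite ?S" "?S \<subseteq> proj_space"
    using X by auto
  have gen: "forms (i + D) \<subseteq> ideal.span (insert s ?I)"
  proof (rule fat_points_generated[OF S assms(3) s _ D])
    show "hilbert_fun ?I i = card ?S * point_degree TYPE('v) m"
      unfolding i_def Y by (rule hilbert_fun_reg_index[OF S assms(3)])
  qed (use s0 in auto)
  \<comment> \<open>\<open>P\<close> lies in \<open>X2\<close>, which is disjoint from
    \<open>X1\<close>, so its deletion leaves all of \<open>X1\<close> in place.\<close>
  have "?I \<subseteq> (\<Inter>Q\<in>X1. ideal_pow (vanishing_ideal {Q}) m)"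
    using assms(9-11) by auto
  then have "?I \<subseteq> CI.V" by (rule subset_trans[OF _ CI.symbolic_power_subset])
  then have "ideal.span (insert s ?I) \<subseteq> ideal.span (insert s CI.V)"
    by (intro ideal.span_mono insert_mono)
  with gen have "hilbert_fun (ideal.span (insert s CI.V)) (i + D) = 0"
    unfolding hilbert_fun_eq_0_iff[OF ideal.subspace_span] by (rule subset_trans)
  then have "\<not> i + D \<le> (\<Sum>i=1..n - 1. ?e i - 1) + (m * ?e n - 1) + (D - 1)"
    using CI.hilbert_fun_V_pos[OF s _ D, of "i + D"] s0 assms(9) by fastforce
  \<comment> \<open>The auxiliary degree drops out: \<open>i + D\<close> exceeds a bound containing
    \<open>D - 1\<close>, which leaves exactly a lower bound for \<open>i\<close>.\<close>
  then have *: "(\<Sum>i=1..n - 1. ?e i - 1) + (m * ?e n - 1) \<le> i"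
    using D by linarith
  \<comment> \<open>Index 1, where \<open>?e\<close> differs from \<open>d\<close>, is split off;
    \<open>n \<ge> 2\<close> puts it among the first \<open>n - 1\<close>. It contributes
    \<open>d 1 - 2\<close>, the other \<open>n - 2\<close> indices \<open>d i - 1\<close> each, and
    the last generator \<open>m * d n - 1\<close>, so the total correction is
    \<open>n + 1\<close>.\<close>
  have n1: "{1..n - 1} = insert 1 {2..n - 1}" using assms(2) by auto
  have "int (?e i - 1) = int (d i) - 1" if "i \<in> {2..n - 1}" for i
  proof -
    have "i \<in> {1..n}" using that by auto
    then show ?thesis using d2[of i] that by (simp add: of_nat_diff)
  qed
  then have "(\<Sum>i=2..n - 1. int (?e i - 1)) = (\<Sum>i=2..n - 1. int (d i) - 1)"
    by (rule sum.cong[OF refl])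
  also have "\<dots> = (\<Sum>i=2..n - 1. int (d i)) - (int n - 2)"
    using assms(2) by (simp add: sum_subtractf of_nat_diff)
  finally have "int (\<Sum>i=1..n - 1. ?e i - 1) = int (d 1) - 2 + (\<Sum>i=2..n - 1. int (d i)) - (int n - 2)"
    unfolding n1 using assms(4) by (simp add: of_nat_diff)
  moreover have "(\<Sum>i=1..n - 1. int (d i)) = int (d 1) + (\<Sum>i=2..n - 1. int (d i))"
    unfolding n1 by simp
  moreover have "int (m * ?e n - 1) = int m * int (d n) - 1"
    using d2[of n] assms(2,3) by (simp add: of_nat_diff)
  moreover have "int (\<Sum>i=1..n - 1. ?e i - 1) + int (m * ?e n - 1) \<le> int i"
    using * by (simp only: of_nat_add[symmetric] of_nat_le_iff)
  ultimately show ?thesis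
    unfolding i_def[symmetric] by linarith
qed

end
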